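(* The (forward) Cauchy completion $M_C^+$ of a generalized metric space $(M,d)$, endowed with the topology generated by the backward open balls of the quasi-distance $d_Q$, satisfies: (i) The topology is $T_0$, and if two distinct points of $M_C^+$ are not Hausdorff related (i.e. do not admit disjoint neighborhoods) then they both lie at the boundary $\partial_C^+M$. (ii) The inclusion $i:M\to M_C^+$ is a homeomorphism onto its image $i(M)$, and $i(M)$ is dense in $M_C^+$. (iii) The quasi-distance $d_Q$ is forward complete, i.e. any forward Cauchy sequence $\{z_n\}\subset M_C^+$ (for $d_Q$) is convergent in $M_C^+$. The analogous statements hold for $d_Q^{\mathrm{rev}}$ on $M_C^-$ (with the topology generated by the backward balls of $d_Q^{\mathrm{rev}}$), while $(M_C^s,\overline d^s)$ is a (necessarily $T_2$) metric space.
   Context: A generalized metric space $(M,d)$ is a set with a map $d:M\times M\to\mathbb R$ satisfying: (a1) $d\ge0$; (a2) $d(x,y)=d(y,x)=0$ iff $x=y$; (a3) triangle inequality $d(x,z)\le d(x,y)+d(y,z)$; (a4) for any sequence $\{x_n\}$ and $x\in M$, $d(x_n,x)\to0$ iff $d(x,x_n)\to0$. Its topology is generated by the forward open balls or, equivalently, by the backward ones. A quasi-distance takes values in $\mathbb R\cup\{\infty\}$ and satisfies (a1), (a2), (a3). $d^{\mathrm{rev}}(x,y)=d(y,x)$, $d^s=\frac12(d+d^{\mathrm{rev}})$. The backward open balls of a quasi-distance $d_Q$ are $B^-(x,r)=\{y:d_Q(y,x)<r\}$; for the topology they generate, $z_n\to z$ iff $d_Q(z_n,z)\to0$. $\{x_n\}$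 is a forward Cauchy sequence (for $d$, or for a quasi-distance) if for all $\epsilon>0$ there is $n_0$ with $d(x_n,x_m)<\epsilon$ whenever $n_0\le n\le m$; a backward Cauchy sequence is a forward Cauchy sequence for $d^{\mathrm{rev}}$. Two forward Cauchy sequences in $M$ are equivalent if $\lim_n(\lim_md(x_n,x'_m))=\lim_n(\lim_md(x'_n,x_m))=0$. $M_C^+$ is the set of equivalence classes of forward Cauchy sequences in $M$; $M$ is regarded as the subset of classes of convergent sequences; $\partial_C^+M=M_C^+\setminus M$. $d_Q([\{x_n\}],[\{y_n\}])=\lim_n(\lim_md(x_n,y_m))$ is a quasi-distance on $M_C^+$. $M_C^-$, $\partial_C^-M$, $d_Q^{\mathrm{rev}}$ are defined in the same way from $d^{\mathrm{rev}}$. $\partial_C^sM=\partial_C^+M\cap\partial_C^-M$ (points represented by the same class of sequences), $M_C^s=M\cup\partial_C^sM$, and $\overline d^s=(d_Q+d_Q^{\mathrm{rev}})/2$ on $M_C^s$. *)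

theory Defs
  imports "HOL-Analysis.Analysis"
begin

locale generalized_metric_space =
  fixes M :: "'a set" and d :: "'a \<Rightarrow> 'a \<Rightarrow> real"
  assumes nonneg: "\<lbrakk>x \<in> M; y \<in> M\<rbrakk> \<Longrightarrow> 0 \<le> d x y"
    and zero: "\<lbrakk>x \<in> M; y \<in> M\<rbrakk> \<Longrightarrow> d x y = 0 \<and> d y x = 0 \<longleftrightarrow> x = y"
    and triangle: "\<lbrakk>x \<in> M; y \<in> M; z \<in> M\<rbrakk> \<Longrightarrow> d x z \<le> d x y + d y z"
    and conv_sym: "\<lbrakk>range s \<subseteq> M; x \<in> M\<rbrakk> \<Longrightarrow>
      ((\<lambda>n. d (s n) x) \<longlonglongrightarrow> 0) \<longleftrightarrow> ((\<lambda>n. d x (s n)) \<longlonglongrightarrow> 0)"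

definition rev_dist :: "('a \<Rightarrow> 'a \<Rightarrow> 'b) \<Rightarrow> 'a \<Rightarrow> 'a \<Rightarrow> 'b" where
  "rev_dist d x y = d y x"

text \<open>Balls, topologies and Cauchy sequences are defined for extended-real valued functions
  on a carrier, so that they apply both to a generalized metric (through \<open>ext_dist\<close>)
  and to a quasi-distance, which may take the value \<open>\<infinity>\<close>.\<close>

definition ext_dist :: "('a \<Rightarrow> 'a \<Rightarrow> real) \<Rightarrow> 'a \<Rightarrow> 'a \<Rightarrow> ereal" where
  "ext_dist d x y = ereal (d x y)"

definition forward_ball :: "'a set \<Rightarrow> ('a \<Rightarrow> 'a \<Rightarrow> ereal) \<Rightarrow> 'a \<Rightarrow> real \<Rightarrow> 'a set" where
  "forward_ball M D x r = {y \<in> M. D x y < ereal r}"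

definition backward_ball :: "'a set \<Rightarrow> ('a \<Rightarrow> 'a \<Rightarrow> ereal) \<Rightarrow> 'a \<Rightarrow> real \<Rightarrow> 'a set" where
  "backward_ball M D x r = {y \<in> M. D y x < ereal r}"

definition forward_topology :: "'a set \<Rightarrow> ('a \<Rightarrow> 'a \<Rightarrow> ereal) \<Rightarrow> 'a topology" where
  "forward_topology M D = topology_generated_by {forward_ball M D x r | x r. x \<in> M \<and> 0 < r}"

definition backward_topology :: "'a set \<Rightarrow> ('a \<Rightarrow> 'a \<Rightarrow> ereal) \<Rightarrow> 'a topology" where
  "backward_topology M D = topology_generated_by {backward_ball M D x r | x r. x \<in> M \<and> 0 < r}"

definition forward_Cauchy :: "'a set \<Rightarrow> ('a \<Rightarrow> 'a \<Rightarrow> ereal) \<Rightarrow> (nat \<Rightarrow> 'a) \<Rightarrow> bool" where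
  "forward_Cauchy M D s \<longleftrightarrow> range s \<subseteq> M \<and>
     (\<forall>e::real. e > 0 \<longrightarrow> (\<exists>N. \<forall>n m. N \<le> n \<and> n \<le> m \<longrightarrow> D (s n) (s m) < ereal e))"

definition forward_complete :: "'a set \<Rightarrow> ('a \<Rightarrow> 'a \<Rightarrow> ereal) \<Rightarrow> bool" where
  "forward_complete M D \<longleftrightarrow>
     (\<forall>z. forward_Cauchy M D z \<longrightarrow> (\<exists>l \<in> M. limitin (backward_topology M D) z l sequentially))"

text \<open>For forward Cauchy sequences both limits exist. The inner one is finite, but the outer
  one may be \<open>\<infinity>\<close>, so the limits are taken in the extended reals.\<close>

definition iterated_lim :: "('a \<Rightarrow> 'a \<Rightarrow> real) \<Rightarrow> (nat \<Rightarrow> 'a) \<Rightarrow> (nat \<Rightarrow> 'a) \<Rightarrow> ereal" where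
  "iterated_lim d s t = lim (\<lambda>n. lim (\<lambda>m. ereal (d (s n) (t m))))"

definition Cauchy_rel :: "'a set \<Rightarrow> ('a \<Rightarrow> 'a \<Rightarrow> real) \<Rightarrow> ((nat \<Rightarrow> 'a) \<times> (nat \<Rightarrow> 'a)) set" where
  "Cauchy_rel M d = {(s, t). forward_Cauchy M (ext_dist d) s \<and> forward_Cauchy M (ext_dist d) t \<and>
     iterated_lim d s t = 0 \<and> iterated_lim d t s = 0}"

text \<open>The completion \<open>M\<^sub>C\<^sup>-\<close>, its boundary and \<open>d\<^sub>Q\<^sup>r\<^sup>e\<^sup>v\<close> are obtained from the following
  definitions by replacing \<open>d\<close> with \<open>rev_dist d\<close>.\<close>

definition Cauchy_completion :: "'a set \<Rightarrow> ('a \<Rightarrow> 'a \<Rightarrow> real) \<Rightarrow> (nat \<Rightarrow> 'a) set set" where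
  "Cauchy_completion M d = {s. forward_Cauchy M (ext_dist d) s} // Cauchy_rel M d"

text \<open>The set inside \<open>the_elem\<close> is a singleton, as the iterated limit does not depend
  on the representatives.\<close>

definition quasi_dist ::
    "('a \<Rightarrow> 'a \<Rightarrow> real) \<Rightarrow> (nat \<Rightarrow> 'a) set \<Rightarrow> (nat \<Rightarrow> 'a) set \<Rightarrow> ereal" where
  "quasi_dist d P Q = the_elem (\<Union>s\<in>P. \<Union>t\<in>Q. {iterated_lim d s t})"

text \<open>The class of the constant sequence at \<open>x\<close> consists of all the sequences in \<open>M\<close> converging
  to \<open>x\<close>, so the image of \<open>M\<close> under this map is the set of classes of convergent sequences.
  For the same reason \<open>d\<close> and \<open>rev_dist d\<close> give the same class.\<close>

definition Cauchy_incl :: "'a set \<Rightarrow> ('a \<Rightarrow> 'a \<Rightarrow> real) \<Rightarrow> 'a \<Rightarrow> (nat \<Rightarrow> 'a) set" where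
  "Cauchy_incl M d x = Cauchy_rel M d `` {\<lambda>n. x}"

definition Cauchy_boundary :: "'a set \<Rightarrow> ('a \<Rightarrow> 'a \<Rightarrow> real) \<Rightarrow> (nat \<Rightarrow> 'a) set set" where
  "Cauchy_boundary M d = Cauchy_completion M d - Cauchy_incl M d ` M"

text \<open>Points are sets of sequences, so the intersection below consists of the classes
  that occur, as the same set of sequences, in both boundaries.\<close>

definition sym_boundary :: "'a set \<Rightarrow> ('a \<Rightarrow> 'a \<Rightarrow> real) \<Rightarrow> (nat \<Rightarrow> 'a) set set" where
  "sym_boundary M d = Cauchy_boundary M d \<inter> Cauchy_boundary M (rev_dist d)"

definition sym_completion :: "'a set \<Rightarrow> ('a \<Rightarrow> 'a \<Rightarrow> real) \<Rightarrow> (nat \<Rightarrow> 'a) set set" where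
  "sym_completion M d = Cauchy_incl M d ` M \<union> sym_boundary M d"

definition sym_dist ::
    "('a \<Rightarrow> 'a \<Rightarrow> real) \<Rightarrow> (nat \<Rightarrow> 'a) set \<Rightarrow> (nat \<Rightarrow> 'a) set \<Rightarrow> ereal" where
  "sym_dist d P Q = (quasi_dist d P Q + quasi_dist (rev_dist d) P Q) / 2"

definition Hausdorff_related :: "'a topology \<Rightarrow> 'a \<Rightarrow> 'a \<Rightarrow> bool" where
  "Hausdorff_related X p q \<longleftrightarrow>
     (\<exists>U V. openin X U \<and> openin X V \<and> p \<in> U \<and> q \<in> V \<and> disjnt U V)"

end

theory Submission
  imports Defs
begin

text \<open>
  For a forward Cauchy sequence \<open>s\<close> the points \<open>s n\<close> satisfy \<open>d\<^sub>Q (s n) [s] \<longlonglongrightarrow> 0\<close>, so \<open>M\<close> is dense for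
  the backward balls. If a point \<open>x\<close> of \<open>M\<close> and a class \<open>q\<close> have no disjoint neighbourhoods,
  density gives points \<open>y\<^sub>n\<close> of \<open>M\<close> with \<open>d y\<^sub>n x \<longlonglongrightarrow> 0\<close> and \<open>d\<^sub>Q y\<^sub>n q \<longlonglongrightarrow> 0\<close>. The symmetry of
  convergence in \<open>M\<close> yields \<open>d x y\<^sub>n \<longlonglongrightarrow> 0\<close>, hence \<open>d\<^sub>Q x q = 0\<close>, and applying it once more to a
  representative of \<open>q\<close> gives \<open>q = x\<close>.

  Given a forward Cauchy sequence of classes \<open>z\<^sub>m = [s\<^sub>m]\<close>, the limit is represented by a diagonal
  sequence \<open>y\<^sub>m\<close>, a term of \<open>s\<^sub>m\<close> taken so late that, up to \<open>1/(m+1)\<close>, the distances to it from a growing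
  finite set are bounded by those to \<open>z\<^sub>m\<close>. Closeness of \<open>y\<^sub>m\<close> to \<open>z\<^sub>m\<close> alone would not suffice, since
  \<open>d\<^sub>Q z\<^sub>m y\<^sub>m\<close> need not be small.

  A class in both completions consists of sequences that are Cauchy in both directions. For these the
  iterated limits in either order agree with the limit of \<open>d (s n) (t n)\<close>, so \<open>d\<^sub>Q\<close> is finite there and
  \<open>d\<^sub>Q\<^sup>r\<^sup>e\<^sup>v\<close> is \<open>d\<^sub>Q\<close> with its arguments swapped.
\<close>

section \<open>Topologies of quasi-distances\<close>

text \<open>Common ground for \<open>M\<close> with \<open>ext_dist d\<close>, \<open>M\<close> with
  the reversed distance, and the completion with \<open>quasi_dist d\<close>: the facts on backward
  balls are proved once and instantiated for all three.\<close>

locale quasi_distance =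
  fixes Q :: "'b set" and D :: "'b \<Rightarrow> 'b \<Rightarrow> ereal"
  assumes nonneg: "\<lbrakk>x \<in> Q; y \<in> Q\<rbrakk> \<Longrightarrow> 0 \<le> D x y"
    and zero: "\<lbrakk>x \<in> Q; y \<in> Q\<rbrakk> \<Longrightarrow> D x y = 0 \<and> D y x = 0 \<longleftrightarrow> x = y"
    and triangle: "\<lbrakk>x \<in> Q; y \<in> Q; z \<in> Q\<rbrakk> \<Longrightarrow> D x z \<le> D x y + D y z"
begin

lemma dist_self: "x \<in> Q \<Longrightarrow> D x x = 0"
  using zero by blast

lemma centre_in_backward_ball: "\<lbrakk>x \<in> Q; 0 < r\<rbrakk> \<Longrightarrow> x \<in> backward_ball Q D x r"
  by (simp add: backward_ball_def dist_self)

lemma backward_ball_interior: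
  assumes p: "p \<in> Q" and x: "x \<in> backward_ball Q D p r"
  shows "\<exists>\<epsilon>>0. backward_ball Q D x \<epsilon> \<subseteq> backward_ball Q D p r"
proof -
  have xQ: "x \<in> Q" and lt: "D x p < ereal r"
    using x by (auto simp: backward_ball_def)
  \<comment> \<open>Lying below a real radius makes \<open>D x p\<close> finite, so
    \<open>r - a\<close> is a genuine real radius. The triangle inequality along \<open>y\<close>,
    \<open>x\<close>, \<open>p\<close> then does the rest.\<close>
  then obtain a where a: "D x p = ereal a"
    using nonneg[OF xQ p] by (cases "D x p") auto
  have "D y p < ereal r" if y: "y \<in> Q" "D y x < ereal (r - a)" for y
  proof -
    obtain b where b: "D y x = ereal b"
      using nonneg[OF y(1) xQ] y(2) by (cases "D y x") auto
    have "D y p \<le> ereal (b + a)"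
      using triangle[OF y(1) xQ p] a b by simp
    also have "\<dots> < ereal r"
      using y(2) b by simp
    finally show ?thesis .
  qed
  then have "backward_ball Q D x (r - a) \<subseteq> backward_ball Q D p r"
    by (auto simp: backward_ball_def)
  moreover have "r - a > 0"
    using lt a by simp
  ultimately show ?thesis by blast
qed

text \<open>The generated topology a priori has the balls only as a subbase. By
  \<open>backward_ball_interior\<close> every ball contains a smaller ball around each of its
  points, and this property survives finite intersections and unions, so the balls form a
  base.\<close>

lemma openin_backward_topology:
  "openin (backward_topology Q D) U \<longleftrightarrow>
     U \<subseteq> Q \<and> (\<forall>x\<in>U. \<exists>r>0. backward_ball Q D x r \<subseteq> U)"
proof
  let ?B = "{backward_ball Q D x r | x r. x \<in> Q \<and> 0 < r}"
  assume "openin (backward_topology Q D) U"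
  then have "generate_topology_on ?B U"
    by (simp add: backward_topology_def openin_topology_generated_by_iff)
  then show "U \<subseteq> Q \<and> (\<forall>x\<in>U. \<exists>r>0. backward_ball Q D x r \<subseteq> U)"
  proof induction
    case Empty
    then show ?case by simp
  next
    case (Int a b)
    have "\<exists>r>0. backward_ball Q D x r \<subseteq> a \<inter> b" if "x \<in> a \<inter> b" for x
    proof -
      obtain r1 where r1: "r1 > 0" "backward_ball Q D x r1 \<subseteq> a"
        using Int.IH(1) \<open>x \<in> a \<inter> b\<close> by auto
      obtain r2 where r2: "r2 > 0" "backward_ball Q D x r2 \<subseteq> b"
        using Int.IH(2) \<open>x \<in> a \<inter> b\<close> by auto
      have "backward_ball Q D x (min r1 r2) \<subseteq> backward_ball Q D x r1 \<inter> backward_ball Q D x r2"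
        by (auto simp: backward_ball_def elim!: order_less_le_trans)
      then have "backward_ball Q D x (min r1 r2) \<subseteq> a \<inter> b"
        using r1 r2 by blast
      moreover have "min r1 r2 > 0"
        using r1 r2 by simp
      ultimately show ?thesis by blast
    qed
    moreover have "a \<inter> b \<subseteq> Q"
      using Int.IH by blast
    ultimately show ?case by simp
  next
    case (UN K)
    have "\<exists>r>0. backward_ball Q D x r \<subseteq> \<Union>K" if x: "x \<in> \<Union>K" for x
    proof -
      obtain k where "k \<in> K" "x \<in> k"
        using x by blast
      then obtain r where "r > 0" "backward_ball Q D x r \<subseteq> k"
        using UN.IH[of k] by blast
      then show ?thesis
        using \<open>k \<in> K\<close> by blast
    qed
    moreover have "\<Union>K \<subseteq> Q"
      using UN.IH by blast
    ultimately show ?case by simp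
  next
    case (Basis s)
    then obtain p r where s: "s = backward_ball Q D p r" "p \<in> Q"
      by blast
    have "s \<subseteq> Q"
      using s by (auto simp: backward_ball_def)
    moreover have "\<exists>r>0. backward_ball Q D x r \<subseteq> s" if "x \<in> s" for x
      using backward_ball_interior[OF s(2)] that s(1) by simp
    ultimately show ?case by simp
  qed
next
  assume U: "U \<subseteq> Q \<and> (\<forall>x\<in>U. \<exists>r>0. backward_ball Q D x r \<subseteq> U)"
  define K where "K = {backward_ball Q D x r | x r. x \<in> Q \<and> 0 < r \<and> backward_ball Q D x r \<subseteq> U}"
  have "U \<subseteq> \<Union>K"
  proof
    fix x assume "x \<in> U"
    then obtain r where "r > 0" "backward_ball Q D x r \<subseteq> U" "x \<in> Q"
      using U by blast
    then have "backward_ball Q D x r \<in> K" "x \<in> backward_ball Q D x r"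
      unfolding K_def by (blast, simp add: centre_in_backward_ball)
    then show "x \<in> \<Union>K"
      by blast
  qed
  moreover have "\<Union>K \<subseteq> U"
    unfolding K_def by blast
  ultimately have "U = \<Union>K"
    by (rule subset_antisym)
  moreover have "openin (backward_topology Q D) (\<Union>K)"
    unfolding backward_topology_def
    by (rule openin_Union, rule topology_generated_by_Basis) (unfold K_def, blast)
  ultimately show "openin (backward_topology Q D) U"
    by simp
qed

lemma openin_backward_ball: "p \<in> Q \<Longrightarrow> openin (backward_topology Q D) (backward_ball Q D p r)"
  unfolding openin_backward_topology
  by (intro conjI ballI backward_ball_interior) (auto simp: backward_ball_def)

lemma topspace_backward_topology: "topspace (backward_topology Q D) = Q"
proof -
  have "backward_ball Q D x 1 \<subseteq> Q" for x
    by (auto simp: backward_ball_def)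
  then have "openin (backward_topology Q D) Q"
    unfolding openin_backward_topology using zero_less_one by blast
  then have "Q \<subseteq> topspace (backward_topology Q D)"
    by (rule openin_subset)
  moreover have "topspace (backward_topology Q D) \<subseteq> Q"
    using openin_topspace[of "backward_topology Q D"] unfolding openin_backward_topology by blast
  ultimately show ?thesis by simp
qed

text \<open>If \<open>D x y\<close> is nonzero, a ball around \<open>y\<close> of radius below
  \<open>D x y\<close> misses \<open>x\<close>. For distinct points only one of the two distances is
  certain to be nonzero, so this separates them in one direction only.\<close>

lemma t0_space_backward_topology: "t0_space (backward_topology Q D)"
proof -
  have sep: "\<exists>U. openin (backward_topology Q D) U \<and> x \<notin> U \<and> y \<in> U"
    if "x \<in> Q" "y \<in> Q" "D x y \<noteq> 0" for x y
  proof -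
    have "0 < D x y"
      using that nonneg[of x y] by simp
    \<comment> \<open>\<open>D x y\<close> may be infinite, so the real radius comes from density
      rather than from a fraction of the distance.\<close>
    then obtain r where "0 < ereal r" "ereal r < D x y"
      using ereal_dense2 by blast
    then show ?thesis
      using that openin_backward_ball[of y r] centre_in_backward_ball[of y r]
      by (intro exI[of _ "backward_ball Q D y r"]) (auto simp: backward_ball_def)
  qed
  show ?thesis
    unfolding t0_space_def topspace_backward_topology
  proof (intro ballI impI)
    fix x y assume *: "x \<in> Q" "y \<in> Q" "x \<noteq> y"
    then have "D x y \<noteq> 0 \<or> D y x \<noteq> 0"
      using zero by blast
    then show "\<exists>U. openin (backward_topology Q D) U \<and> (x \<notin> U \<longleftrightarrow> y \<in> U)"
      using sep[of x y] sep[of y x] * by blast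
  qed
qed

lemma limitin_backward_topologyI:
  assumes "l \<in> Q" "range z \<subseteq> Q"
    and "\<And>e::real. e > 0 \<Longrightarrow> \<forall>\<^sub>F n in F. D (z n) l < ereal e"
  shows "limitin (backward_topology Q D) z l F"
  unfolding limitin_def topspace_backward_topology
proof (intro conjI allI impI)
  fix U assume "openin (backward_topology Q D) U \<and> l \<in> U"
  then obtain r where r: "r > 0" "backward_ball Q D l r \<subseteq> U"
    unfolding openin_backward_topology by blast
  show "\<forall>\<^sub>F n in F. z n \<in> U"
    using assms(3)[OF r(1)] by eventually_elim (use r assms(2) in \<open>auto simp: backward_ball_def\<close>)
qed (use assms in auto)

end

lemma forward_topology_eq_backward: "forward_topology Q D = backward_topology Q (rev_dist D)"
  by (simp add: forward_topology_def backward_topology_def forward_ball_def backward_ball_def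
      rev_dist_def)

lemma rev_dist_rev_dist [simp]: "rev_dist (rev_dist D) = D"
  by (simp add: rev_dist_def fun_eq_iff)

lemma ext_dist_rev_dist: "ext_dist (rev_dist d) = rev_dist (ext_dist d)"
  by (simp add: rev_dist_def ext_dist_def fun_eq_iff)

section \<open>Iterated limits of forward Cauchy sequences\<close>

text \<open>Serves the outer limit of \<open>iterated_lim\<close>, which may be infinite. Each late
  \<open>f n\<close> is at most the lower limit plus \<open>e\<close>, hence so is the upper limit,
  and \<open>e\<close> is arbitrary.\<close>

lemma ereal_convergent_if_almost_incseq:
  fixes f :: "nat \<Rightarrow> ereal"
  assumes "\<And>e::real. e > 0 \<Longrightarrow> \<exists>N. \<forall>n m. N \<le> n \<and> n \<le> m \<longrightarrow> f n \<le> f m + ereal e"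
  shows "convergent f"
proof -
  have "limsup f \<le> liminf f + ereal e" if e: "e > 0" for e
  proof -
    obtain N where N: "\<And>n m. N \<le> n \<Longrightarrow> n \<le> m \<Longrightarrow> f n \<le> f m + ereal e"
      using assms[OF e] by blast
    have "f n \<le> liminf f + ereal e" if "N \<le> n" for n
    proof -
      have "f n - ereal e \<le> liminf f"
        using N that by (intro Liminf_bounded eventually_sequentiallyI[of n])
          (simp add: ereal_minus_le)
      then show ?thesis by (simp add: ereal_minus_le)
    qed
    then show ?thesis
      by (intro Limsup_bounded eventually_sequentiallyI[of N])
  qed
  then have "limsup f \<le> liminf f"
    using ereal_le_epsilon2 by blast
  then have "limsup f = liminf f"
    using Liminf_le_Limsup[OF trivial_limit_sequentially, of f] by simp
  then show ?thesis
    using tendsto_iff_Liminf_eq_Limsup[OF trivial_limit_sequentially, of f] by (auto simp: convergent_def)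
qed

text \<open>Serves the inner limit of \<open>iterated_lim\<close>. The negated sequence is almost
  increasing, and the limit is finite because it lies between 0 and \<open>f N + 1\<close>.\<close>

lemma real_convergent_if_almost_decseq:
  fixes f :: "nat \<Rightarrow> real"
  assumes pos: "\<And>n. 0 \<le> f n"
    and dec: "\<And>e. e > 0 \<Longrightarrow> \<exists>N. \<forall>n m. N \<le> n \<and> n \<le> m \<longrightarrow> f m \<le> f n + e"
  shows "convergent f"
proof -
  define g where "g n = - ereal (f n)" for n
  have "convergent g"
  proof (rule ereal_convergent_if_almost_incseq)
    fix e :: real assume "e > 0"
    then obtain N where N: "\<And>n m. N \<le> n \<Longrightarrow> n \<le> m \<Longrightarrow> f m \<le> f n + e"
      using dec by blast
    show "\<exists>N. \<forall>n m. N \<le> n \<and> n \<le> m \<longrightarrow> g n \<le> g m + ereal e"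
      using N by (intro exI[of _ N]) (auto simp: g_def algebra_simps)
  qed
  then obtain l where "g \<longlonglongrightarrow> l"
    by (auto simp: convergent_def)
  from tendsto_uminus_ereal[OF this] have l: "(\<lambda>n. ereal (f n)) \<longlonglongrightarrow> - l"
    by (simp add: g_def)
  obtain N where N: "\<And>m. N \<le> m \<Longrightarrow> f m \<le> f N + 1"
    using dec[of 1] by auto
  have "- l \<le> ereal (f N + 1)"
    using N by (intro tendsto_upperbound[OF l] eventually_sequentiallyI[of N]) auto
  moreover have "0 \<le> - l"
    using pos by (intro tendsto_lowerbound[OF l]) auto
  ultimately obtain r where "- l = ereal r"
    by (cases "- l") auto
  then show ?thesis
    using l by (auto simp: convergent_def)
qed

lemma LIMSEQ_0_if_le_inverse:
  fixes f :: "nat \<Rightarrow> real"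
  assumes "\<And>n. 0 \<le> f n" "\<And>n. f n \<le> inverse (real (Suc n))"
  shows "f \<longlonglongrightarrow> 0"
  using assms by (intro tendsto_sandwich[OF _ _ tendsto_const LIMSEQ_inverse_real_of_nat]) auto

context generalized_metric_space
begin

abbreviation "fC \<equiv> forward_Cauchy M (ext_dist d)"
text \<open>Points of \<open>M\<close> enter as constant sequences:
  \<open>L (\<lambda>_. x) t\<close> is the inner limit alone, that is, the quasi-distance from the
  point \<open>x\<close> to the class of \<open>t\<close>.\<close>

abbreviation "L \<equiv> iterated_lim d"
abbreviation "cls s \<equiv> Cauchy_rel M d `` {s}"

lemma dist_self: "x \<in> M \<Longrightarrow> d x x = 0"
  using zero by blast

lemma fC_in: "fC s \<Longrightarrow> s n \<in> M"
  by (auto simp: forward_Cauchy_def)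

lemma fC_iff:
  "fC s \<longleftrightarrow> range s \<subseteq> M \<and> (\<forall>e>0. \<exists>N. \<forall>n m. N \<le> n \<and> n \<le> m \<longrightarrow> d (s n) (s m) < e)"
  by (simp add: forward_Cauchy_def ext_dist_def)

lemma fC_const: "x \<in> M \<Longrightarrow> fC (\<lambda>_. x)"
  by (auto simp: fC_iff dist_self)

text \<open>By the triangle inequality \<open>d x (t m)\<close> exceeds \<open>d x (t n)\<close> by
  at most \<open>d (t n) (t m)\<close>, which is small for late \<open>n \<le> m\<close>: the
  sequence almost decreases.\<close>

lemma point_lim_exists:
  assumes "x \<in> M" "fC t"
  obtains r where "(\<lambda>m. d x (t m)) \<longlonglongrightarrow> r" "L (\<lambda>_. x) t = ereal r" "0 \<le> r"
proof -
  have "convergent (\<lambda>m. d x (t m))"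
  proof (rule real_convergent_if_almost_decseq)
    fix e :: real assume "e > 0"
    then obtain N where N: "\<And>n m. N \<le> n \<Longrightarrow> n \<le> m \<Longrightarrow> d (t n) (t m) < e"
      using assms(2) fC_iff by meson
    have "d x (t m) \<le> d x (t n) + e" if "N \<le> n \<and> n \<le> m" for n m
      using triangle[of x "t n" "t m"] N[of n m] that assms fC_in by fastforce
    then show "\<exists>N. \<forall>n m. N \<le> n \<and> n \<le> m \<longrightarrow> d x (t m) \<le> d x (t n) + e"
      by blast
  qed (use assms nonneg fC_in in blast)
  then obtain r where r: "(\<lambda>m. d x (t m)) \<longlonglongrightarrow> r"
    by (auto simp: convergent_def)
  have "lim (\<lambda>m. ereal (d x (t m))) = ereal r"
    using r by (intro limI) simp
  then have "L (\<lambda>_. x) t = ereal r"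
    unfolding iterated_lim_def by (simp add: limI)
  moreover have "0 \<le> r"
    using assms nonneg fC_in by (intro LIMSEQ_le_const[OF r]) auto
  ultimately show ?thesis using r that by blast
qed

lemma point_lim_tendsto:
  assumes "x \<in> M" "fC t"
  shows "(\<lambda>m. ereal (d x (t m))) \<longlonglongrightarrow> L (\<lambda>_. x) t"
  using point_lim_exists[OF assms] by (metis lim_ereal)

lemma point_lim_nonneg: "\<lbrakk>x \<in> M; fC t\<rbrakk> \<Longrightarrow> 0 \<le> L (\<lambda>_. x) t"
  using point_lim_exists by (metis ereal_less_eq(5))

lemma iterated_lim_consts [simp]: "L (\<lambda>_. x) (\<lambda>_. y) = ereal (d x y)"
  unfolding iterated_lim_def by (simp add: limI)

lemma point_lim_le:
  assumes "x \<in> M" "y \<in> M" "fC t"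
  shows "L (\<lambda>_. x) t \<le> ereal (d x y) + L (\<lambda>_. y) t"
proof (rule LIMSEQ_le[OF point_lim_tendsto])
  show "(\<lambda>m. ereal (d x y) + ereal (d y (t m))) \<longlonglongrightarrow> ereal (d x y) + L (\<lambda>_. y) t"
    using assms nonneg fC_in point_lim_nonneg[of y t]
    by (intro tendsto_add_ereal_nonneg point_lim_tendsto tendsto_const) auto
  show "\<exists>N. \<forall>n\<ge>N. ereal (d x (t n)) \<le> ereal (d x y) + ereal (d y (t n))"
    using assms triangle fC_in by auto
qed (use assms in auto)

text \<open>Here the forward Cauchy condition on \<open>s\<close> works on the first argument, so
  the inner limits almost increase, and nothing keeps them bounded.\<close>

lemma iterated_lim_tendsto:
  assumes s: "fC s" and t: "fC t"
  shows "(\<lambda>n. L (\<lambda>_. s n) t) \<longlonglongrightarrow> L s t"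
proof -
  have "convergent (\<lambda>n. L (\<lambda>_. s n) t)"
  proof (rule ereal_convergent_if_almost_incseq)
    fix e :: real assume "e > 0"
    then obtain N where N: "\<And>n m. N \<le> n \<Longrightarrow> n \<le> m \<Longrightarrow> d (s n) (s m) < e"
      using s fC_iff by meson
    have "L (\<lambda>_. s n) t \<le> L (\<lambda>_. s m) t + ereal e" if "N \<le> n" "n \<le> m" for n m
    proof -
      have "L (\<lambda>_. s n) t \<le> ereal (d (s n) (s m)) + L (\<lambda>_. s m) t"
        using s t fC_in by (intro point_lim_le)
      also have "\<dots> \<le> ereal e + L (\<lambda>_. s m) t"
        using N[OF that] by (intro add_right_mono) simp
      finally show ?thesis by (simp add: add.commute)
    qed
    then show "\<exists>N. \<forall>n m. N \<le> n \<and> n \<le> m \<longrightarrow> L (\<lambda>_. s n) t \<le> L (\<lambda>_. s m) t + ereal e"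
      by blast
  qed
  moreover have "L (\<lambda>_. s n) t = lim (\<lambda>m. ereal (d (s n) (t m)))" for n
    by (simp add: iterated_lim_def limI)
  ultimately show ?thesis
    by (simp add: iterated_lim_def convergent_LIMSEQ_iff)
qed

lemma iterated_lim_nonneg:
  assumes "fC s" "fC t"
  shows "0 \<le> L s t"
  using assms point_lim_nonneg fC_in by (intro tendsto_lowerbound[OF iterated_lim_tendsto]) auto

text \<open>The triangle inequality passes to the limit one sequence at a time: first the target
  (\<open>point_lim_le\<close>), now the intermediate point running along \<open>t\<close>, finally
  the source (\<open>iterated_lim_triangle\<close>). Nonnegativity allows adding limits that may be
  infinite.\<close>

lemma point_iterated_lim_le:
  assumes x: "x \<in> M" and t: "fC t" and u: "fC u"
  shows "L (\<lambda>_. x) u \<le> L (\<lambda>_. x) t + L t u"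
proof (rule LIMSEQ_le[OF tendsto_const])
  show "(\<lambda>n. ereal (d x (t n)) + L (\<lambda>_. t n) u) \<longlonglongrightarrow> L (\<lambda>_. x) t + L t u"
    using assms nonneg fC_in point_lim_nonneg iterated_lim_nonneg[of t u] point_lim_nonneg[of x t]
    by (intro tendsto_add_ereal_nonneg point_lim_tendsto iterated_lim_tendsto always_eventually) auto
  show "\<exists>N. \<forall>n\<ge>N. L (\<lambda>_. x) u \<le> ereal (d x (t n)) + L (\<lambda>_. t n) u"
    using assms point_lim_le fC_in by auto
qed

lemma iterated_lim_triangle:
  assumes s: "fC s" and t: "fC t" and u: "fC u"
  shows "L s u \<le> L s t + L t u"
proof (rule LIMSEQ_le[OF iterated_lim_tendsto[OF s u]])
  show "(\<lambda>n. L (\<lambda>_. s n) t + L t u) \<longlonglongrightarrow> L s t + L t u"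
    using assms fC_in point_lim_nonneg iterated_lim_nonneg[of s t] iterated_lim_nonneg[of t u]
    by (intro tendsto_add_ereal_nonneg iterated_lim_tendsto tendsto_const always_eventually) auto
  show "\<exists>N. \<forall>n\<ge>N. L (\<lambda>_. s n) u \<le> L (\<lambda>_. s n) t + L t u"
    using assms point_iterated_lim_le fC_in by auto
qed

text \<open>The inner limit only involves indices \<open>m \<ge> n\<close>, which is exactly the
  range that the forward Cauchy condition controls.\<close>

lemma point_lim_self_tendsto_0:
  assumes s: "fC s"
  shows "(\<lambda>n. L (\<lambda>_. s n) s) \<longlonglongrightarrow> 0"
proof (rule order_tendstoI)
  fix a :: ereal assume "a < 0"
  then show "\<forall>\<^sub>F n in sequentially. a < L (\<lambda>_. s n) s"
    using s point_lim_nonneg fC_in by (intro always_eventually allI) (blast intro: order_less_le_trans)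
next
  fix a :: ereal assume "0 < a"
  then obtain e where e: "0 < ereal e" "ereal e < a"
    using ereal_dense2 by blast
  then obtain N where N: "\<And>n m. N \<le> n \<Longrightarrow> n \<le> m \<Longrightarrow> d (s n) (s m) < e"
    using s fC_iff by (metis ereal_less(2))
  have "L (\<lambda>_. s n) s \<le> ereal e" if "N \<le> n" for n
    using N that by (intro tendsto_upperbound[OF point_lim_tendsto[OF fC_in[OF s] s]]
        eventually_sequentiallyI[of n]) (auto intro: less_imp_le)
  then show "\<forall>\<^sub>F n in sequentially. L (\<lambda>_. s n) s < a"
    using e by (intro eventually_sequentiallyI[of N]) (auto intro: order_le_less_trans)
qed

lemma iterated_lim_self: "fC s \<Longrightarrow> L s s = 0"
  using LIMSEQ_unique[OF iterated_lim_tendsto point_lim_self_tendsto_0] by blast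

section \<open>The Cauchy completion as a quasi-distance space\<close>

lemma equiv_Cauchy_rel: "equiv {s. fC s} (Cauchy_rel M d)"
proof (intro equivI)
  show "Cauchy_rel M d \<subseteq> {s. fC s} \<times> {s. fC s}"
    by (auto simp: Cauchy_rel_def)
  show "refl_on {s. fC s} (Cauchy_rel M d)"
    by (auto simp: refl_on_def Cauchy_rel_def iterated_lim_self)
  show "sym (Cauchy_rel M d)"
    by (auto simp: sym_def Cauchy_rel_def)
  show "trans (Cauchy_rel M d)"
  proof (rule transI)
    fix s t u assume "(s, t) \<in> Cauchy_rel M d" "(t, u) \<in> Cauchy_rel M d"
    then show "(s, u) \<in> Cauchy_rel M d"
      using iterated_lim_triangle[of s t u] iterated_lim_triangle[of u t s]
        iterated_lim_nonneg[of s u] iterated_lim_nonneg[of u s]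
      by (auto simp: Cauchy_rel_def)
  qed
qed

lemma cls_in: "fC s \<Longrightarrow> cls s \<in> Cauchy_completion M d"
  by (auto simp: Cauchy_completion_def intro: quotientI)

lemma completionE:
  assumes "p \<in> Cauchy_completion M d"
  obtains s where "fC s" "p = cls s"
  using assms by (auto simp: Cauchy_completion_def elim: quotientE)

lemma in_cls_self: "fC s \<Longrightarrow> s \<in> cls s"
  using equiv_class_self[OF equiv_Cauchy_rel] by simp

text \<open>Any member of a class may serve as its representative. This later lets one sequence
  represent a point in both completions.\<close>

lemma completion_eq_cls: "\<lbrakk>p \<in> Cauchy_completion M d; s \<in> p\<rbrakk> \<Longrightarrow> fC s \<and> p = cls s"
  using equiv_class_eq[OF equiv_Cauchy_rel, of _ s]
  by (elim completionE) (auto simp: Cauchy_rel_def)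

lemma cls_eq_iff: "\<lbrakk>fC s; fC t\<rbrakk> \<Longrightarrow> cls s = cls t \<longleftrightarrow> L s t = 0 \<and> L t s = 0"
  using eq_equiv_class_iff[OF equiv_Cauchy_rel, of s t] by (auto simp: Cauchy_rel_def)

text \<open>Replacing either representative by an equivalent one costs 0 in the triangle inequality,
  in both directions. Hence the set inside \<open>the_elem\<close> is a singleton.\<close>

lemma quasi_dist_cls:
  assumes s: "fC s" and t: "fC t"
  shows "quasi_dist d (cls s) (cls t) = L s t"
proof -
  have "L s' t' = L s t" if "s' \<in> cls s" "t' \<in> cls t" for s' t'
  proof -
    have *: "fC s'" "fC t'" "L s s' = 0" "L s' s = 0" "L t t' = 0" "L t' t = 0"
      using that by (auto simp: Cauchy_rel_def)
    have "L s t \<le> L s s' + (L s' t' + L t' t)"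
      by (rule order_trans[OF iterated_lim_triangle[OF s *(1) t]
            add_left_mono[OF iterated_lim_triangle[OF *(1,2) t]]])
    moreover have "L s' t' \<le> L s' s + (L s t + L t t')"
      by (rule order_trans[OF iterated_lim_triangle[OF *(1) s *(2)]
            add_left_mono[OF iterated_lim_triangle[OF s t *(2)]]])
    ultimately show ?thesis
      using *(3-) by (simp add: antisym)
  qed
  then have "(\<Union>s'\<in>cls s. \<Union>t'\<in>cls t. {L s' t'}) = {L s t}"
    using in_cls_self[OF s] in_cls_self[OF t] by blast
  then show ?thesis
    by (simp only: quasi_dist_def the_elem_eq)
qed

lemma quasi_distance_completion: "quasi_distance (Cauchy_completion M d) (quasi_dist d)"
proof
  fix p q r
  assume "p \<in> Cauchy_completion M d" and "q \<in> Cauchy_completion M d"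
  then obtain s t where st: "fC s" "p = cls s" "fC t" "q = cls t"
    by (auto elim!: completionE)
  show "0 \<le> quasi_dist d p q"
    using st by (simp add: quasi_dist_cls iterated_lim_nonneg)
  show "quasi_dist d p q = 0 \<and> quasi_dist d q p = 0 \<longleftrightarrow> p = q"
    using st by (simp add: quasi_dist_cls cls_eq_iff)
  assume "r \<in> Cauchy_completion M d"
  then obtain u where "fC u" "r = cls u"
    by (auto elim: completionE)
  then show "quasi_dist d p r \<le> quasi_dist d p q + quasi_dist d q r"
    using st by (simp add: quasi_dist_cls iterated_lim_triangle)
qed

sublocale completion: quasi_distance "Cauchy_completion M d" "quasi_dist d"
  by (rule quasi_distance_completion)

section \<open>The inclusion of \<open>M\<close> and its density\<close>

lemma incl_in: "x \<in> M \<Longrightarrow> Cauchy_incl M d x \<in> Cauchy_completion M d"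
  by (simp add: Cauchy_incl_def cls_in fC_const)

lemma quasi_dist_incl: "\<lbrakk>x \<in> M; y \<in> M\<rbrakk> \<Longrightarrow>
    quasi_dist d (Cauchy_incl M d x) (Cauchy_incl M d y) = ereal (d x y)"
  by (simp add: Cauchy_incl_def quasi_dist_cls fC_const)

lemma inj_on_incl: "inj_on (Cauchy_incl M d) M"
proof (rule inj_onI)
  fix x y assume *: "x \<in> M" "y \<in> M" "Cauchy_incl M d x = Cauchy_incl M d y"
  then have "d x y = 0 \<and> d y x = 0"
    by (simp add: Cauchy_incl_def cls_eq_iff fC_const)
  then show "x = y"
    using * zero by blast
qed

lemma incl_dense:
  assumes "p \<in> Cauchy_completion M d" "e > 0"
  shows "\<exists>x\<in>M. quasi_dist d (Cauchy_incl M d x) p < ereal e"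
proof -
  obtain s where s: "fC s" "p = cls s"
    using assms(1) by (auto elim: completionE)
  \<comment> \<open>Late terms of a representative are the approximating points of
    \<open>M\<close>.\<close>
  have "\<forall>\<^sub>F n in sequentially. L (\<lambda>_. s n) s < ereal e"
    using order_tendstoD(2)[OF point_lim_self_tendsto_0[OF s(1)]] assms(2) by simp
  then obtain n where "L (\<lambda>_. s n) s < ereal e"
    using eventually_happens'[OF sequentially_bot] by blast
  then show ?thesis
    using s fC_in[OF s(1)] by (intro bexI[of _ "s n"]) (simp_all add: Cauchy_incl_def quasi_dist_cls fC_const)
qed

lemma closure_of_incl:
  "backward_topology (Cauchy_completion M d) (quasi_dist d) closure_of (Cauchy_incl M d ` M)
     = Cauchy_completion M d"
  (is "?T closure_of _ = ?C")
proof (intro subset_antisym subsetI)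
  fix p assume "p \<in> ?T closure_of (Cauchy_incl M d ` M)"
  then show "p \<in> ?C"
    using closure_of_subset_topspace[of ?T] unfolding completion.topspace_backward_topology
    by (rule rev_subsetD)
next
  fix p assume p: "p \<in> ?C"
  have "\<exists>y. y \<in> Cauchy_incl M d ` M \<and> y \<in> U" if U: "p \<in> U \<and> openin ?T U" for U
  proof -
    have "\<forall>q\<in>U. \<exists>r>0. backward_ball ?C (quasi_dist d) q r \<subseteq> U"
      using U unfolding completion.openin_backward_topology by (elim conjE)
    then obtain r where r: "r > 0" "backward_ball ?C (quasi_dist d) p r \<subseteq> U"
      using U by blast
    obtain x where x: "x \<in> M" "quasi_dist d (Cauchy_incl M d x) p < ereal r"
      using incl_dense[OF p r(1)] by blast
    then have "Cauchy_incl M d x \<in> backward_ball ?C (quasi_dist d) p r"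
      using incl_in by (simp add: backward_ball_def)
    then show ?thesis
      using r(2) x(1) by blast
  qed
  then show "p \<in> ?T closure_of (Cauchy_incl M d ` M)"
    unfolding in_closure_of completion.topspace_backward_topology using p by blast
qed

text \<open>The axioms are stable under swapping the arguments of \<open>d\<close>, so every result
  of this locale has a twin for \<open>rev_dist d\<close> by instantiation.\<close>

lemma rev_space: "generalized_metric_space M (rev_dist d)"
proof
  show "((\<lambda>n. rev_dist d (s n) x) \<longlonglongrightarrow> 0) \<longleftrightarrow> ((\<lambda>n. rev_dist d x (s n)) \<longlonglongrightarrow> 0)"
    if "range s \<subseteq> M" "x \<in> M" for s x
    using conv_sym[OF that] by (simp add: rev_dist_def)
  show "rev_dist d x z \<le> rev_dist d x y + rev_dist d y z" if "x \<in> M" "y \<in> M" "z \<in> M" for x y z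
    using triangle[of z y x] that by (simp add: rev_dist_def)
  show "rev_dist d x y = 0 \<and> rev_dist d y x = 0 \<longleftrightarrow> x = y" if "x \<in> M" "y \<in> M" for x y
    using zero[OF that] by (auto simp: rev_dist_def)
qed (simp add: rev_dist_def nonneg)

section \<open>The topology of \<open>M\<close> and its embedding\<close>

lemma quasi_distance_ext_dist: "quasi_distance M (ext_dist d)"
proof
  show "ext_dist d x y = 0 \<and> ext_dist d y x = 0 \<longleftrightarrow> x = y" if "x \<in> M" "y \<in> M" for x y
    using zero[OF that] by (simp add: ext_dist_def)
qed (simp_all add: ext_dist_def nonneg triangle)

sublocale base: quasi_distance M "ext_dist d"
  by (rule quasi_distance_ext_dist)

sublocale base_rev: quasi_distance M "rev_dist (ext_dist d)"
  using generalized_metric_space.quasi_distance_ext_dist[OF rev_space] by (simp add: ext_dist_rev_dist)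

text \<open>This is the symmetry of convergence in terms of balls. If it failed, the radii
  \<open>1/(n+1)\<close> would give points \<open>s n\<close> with \<open>d (s n) x\<close> tending
  to 0 while \<open>d x (s n)\<close> stays above \<open>r\<close>.\<close>

lemma backward_ball_in_forward_ball:
  assumes x: "x \<in> M" and r: "r > 0"
  shows "\<exists>\<delta>>0. backward_ball M (ext_dist d) x \<delta> \<subseteq> backward_ball M (rev_dist (ext_dist d)) x r"
proof (rule ccontr)
  assume "\<not> ?thesis"
  then have no: "\<not> backward_ball M (ext_dist d) x \<delta> \<subseteq> backward_ball M (rev_dist (ext_dist d)) x r"
    if "\<delta> > 0" for \<delta>
    using that by blast
  have "\<exists>y. y \<in> M \<and> d y x < inverse (real (Suc n)) \<and> r \<le> d x y" for n
    using no[of "inverse (real (Suc n))"]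
    by (auto simp: backward_ball_def rev_dist_def ext_dist_def not_less)
  then obtain s where s: "\<And>n. s n \<in> M" "\<And>n. d (s n) x < inverse (real (Suc n))" "\<And>n. r \<le> d x (s n)"
    by metis
  have "(\<lambda>n. d (s n) x) \<longlonglongrightarrow> 0"
    using s(1) x nonneg by (intro LIMSEQ_0_if_le_inverse less_imp_le[OF s(2)]) auto
  then have "(\<lambda>n. d x (s n)) \<longlonglongrightarrow> 0"
    using conv_sym[of s x] s(1) x by blast
  then have "r \<le> 0"
    using s(3) by (intro LIMSEQ_le_const) auto
  then show False using r by simp
qed

lemma openin_forward_imp_backward:
  assumes "openin (forward_topology M (ext_dist d)) U"
  shows "openin (backward_topology M (ext_dist d)) U"
proof -
  have U: "U \<subseteq> M" "\<forall>x\<in>U. \<exists>r>0. backward_ball M (rev_dist (ext_dist d)) x r \<subseteq> U"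
    using assms base_rev.openin_backward_topology[of U] by (simp_all add: forward_topology_eq_backward)
  have "\<exists>r>0. backward_ball M (ext_dist d) x r \<subseteq> U" if xU: "x \<in> U" for x
  proof -
    obtain r where r: "r > 0" "backward_ball M (rev_dist (ext_dist d)) x r \<subseteq> U"
      using U(2) xU by blast
    have "x \<in> M"
      using U(1) xU by blast
    then obtain \<delta> where "\<delta> > 0" "backward_ball M (ext_dist d) x \<delta> \<subseteq> backward_ball M (rev_dist (ext_dist d)) x r"
      using backward_ball_in_forward_ball[OF _ r(1)] by blast
    then show ?thesis
      using order_trans[OF _ r(2)] by blast
  qed
  then show ?thesis
    unfolding base.openin_backward_topology using U(1) by simp
qed

lemma forward_topology_eq_backward_topology:
  "forward_topology M (ext_dist d) = backward_topology M (ext_dist d)"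
proof (unfold topology_eq, intro allI iffI)
  fix U assume "openin (backward_topology M (ext_dist d)) U"
  \<comment> \<open>Reversal exchanges the two topologies, so the inclusion already proved, read in
    the reversed space, is the missing one.\<close>
  then have "openin (forward_topology M (ext_dist (rev_dist d))) U"
    by (simp add: forward_topology_eq_backward ext_dist_rev_dist)
  then have "openin (backward_topology M (ext_dist (rev_dist d))) U"
    by (rule generalized_metric_space.openin_forward_imp_backward[OF rev_space])
  then show "openin (forward_topology M (ext_dist d)) U"
    by (simp add: forward_topology_eq_backward ext_dist_rev_dist)
qed (rule openin_forward_imp_backward)

text \<open>The inclusion preserves distances, so a ball of the completion centred at a point of
  \<open>M\<close> meets \<open>M\<close> in the ball of the same centre and radius. This gives both
  continuity and openness onto the image.\<close>

lemma embedding_map_incl: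
  "embedding_map (forward_topology M (ext_dist d))
     (backward_topology (Cauchy_completion M d) (quasi_dist d)) (Cauchy_incl M d)"
  (is "embedding_map _ ?T ?i")
proof -
  let ?X = "backward_topology M (ext_dist d)"
  let ?C = "Cauchy_completion M d"
  have ball_iff: "?i y \<in> backward_ball ?C (quasi_dist d) (?i x) r \<longleftrightarrow> y \<in> backward_ball M (ext_dist d) x r"
    if "x \<in> M" "y \<in> M" for x y r
    using that by (simp add: backward_ball_def quasi_dist_incl incl_in ext_dist_def)
  have ball_M: "backward_ball M (ext_dist d) x r \<subseteq> M" for x r
    by (auto simp: backward_ball_def)
  have "continuous_map ?X ?T ?i"
    unfolding continuous_map_def base.topspace_backward_topology completion.topspace_backward_topology
  proof (intro conjI allI impI)
    fix V assume "openin ?T V"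
    then have V: "\<forall>p\<in>V. \<exists>r>0. backward_ball ?C (quasi_dist d) p r \<subseteq> V"
      unfolding completion.openin_backward_topology by (elim conjE)
    have "\<exists>r>0. backward_ball M (ext_dist d) x r \<subseteq> {x \<in> M. ?i x \<in> V}" if x: "x \<in> M" "?i x \<in> V" for x
    proof -
      obtain r where "r > 0" "backward_ball ?C (quasi_dist d) (?i x) r \<subseteq> V"
        using V x(2) by blast
      moreover have "y \<in> M \<and> ?i y \<in> backward_ball ?C (quasi_dist d) (?i x) r"
        if "y \<in> backward_ball M (ext_dist d) x r" for y
        using that ball_M[of x r] ball_iff[OF x(1), of y r] by blast
      ultimately have "backward_ball M (ext_dist d) x r \<subseteq> {x \<in> M. ?i x \<in> V}"
        by blast
      with \<open>r > 0\<close> show ?thesis by blast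
    qed
    then show "openin ?X {x \<in> M. ?i x \<in> V}"
      unfolding base.openin_backward_topology by simp
  qed (simp add: incl_in)
  then have cont: "continuous_map ?X (subtopology ?T (?i ` M)) ?i"
    by (simp add: continuous_map_in_subtopology base.topspace_backward_topology image_subset_iff_funcset)
  have "open_map ?X (subtopology ?T (?i ` M)) ?i"
    unfolding open_map_def
  proof (intro allI impI)
    fix U assume "openin ?X U"
    then have U: "U \<subseteq> M" "\<forall>x\<in>U. \<exists>r>0. backward_ball M (ext_dist d) x r \<subseteq> U"
      unfolding base.openin_backward_topology by blast+
    \<comment> \<open>The open set of the completion that cuts out the image of \<open>U\<close>:
      all balls centred in \<open>M\<close> whose trace on \<open>M\<close> stays inside
      \<open>U\<close>.\<close>
    define K where "K = {backward_ball ?C (quasi_dist d) (?i x) r | x r.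
        x \<in> M \<and> 0 < r \<and> backward_ball M (ext_dist d) x r \<subseteq> U}"
    have "openin ?T (\<Union>K)"
    proof (rule openin_Union)
      fix B assume "B \<in> K"
      then obtain x r where "x \<in> M" "B = backward_ball ?C (quasi_dist d) (?i x) r"
        unfolding K_def by blast
      then show "openin ?T B"
        using completion.openin_backward_ball incl_in by simp
    qed
    moreover have "?i ` U = \<Union>K \<inter> ?i ` M"
    proof (intro subset_antisym subsetI)
      fix p assume "p \<in> ?i ` U"
      then obtain x where x: "x \<in> U" "p = ?i x"
        by blast
      then obtain r where r: "r > 0" "backward_ball M (ext_dist d) x r \<subseteq> U"
        using U(2) by blast
      then have "backward_ball ?C (quasi_dist d) p r \<in> K"
        using x U(1) unfolding K_def by blast
      moreover have "x \<in> M"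
        using x(1) U(1) by blast
      then have "p \<in> backward_ball ?C (quasi_dist d) p r"
        using completion.centre_in_backward_ball[OF incl_in r(1)] x(2) by simp
      ultimately show "p \<in> \<Union>K \<inter> ?i ` M"
        using x U(1) by blast
    next
      fix p assume "p \<in> \<Union>K \<inter> ?i ` M"
      then obtain x y r where "x \<in> M" "y \<in> M" "p = ?i y" "backward_ball M (ext_dist d) x r \<subseteq> U"
        "p \<in> backward_ball ?C (quasi_dist d) (?i x) r"
        unfolding K_def by blast
      then have "p = ?i y" "y \<in> U"
        using ball_iff[of x y r] by auto
      then show "p \<in> ?i ` U"
        by blast
    qed
    ultimately show "openin (subtopology ?T (?i ` M)) (?i ` U)"
      unfolding openin_subtopology by blast
  qed
  moreover have "?i ` topspace ?X = topspace (subtopology ?T (?i ` M))"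
    using incl_in
    by (simp add: base.topspace_backward_topology completion.topspace_backward_topology
        inf.absorb2 image_subset_iff)
  ultimately have "homeomorphic_map ?X (subtopology ?T (?i ` M)) ?i"
    using cont inj_on_incl
    by (intro bijective_open_imp_homeomorphic_map) (simp_all only: base.topspace_backward_topology)
  then show ?thesis
    unfolding forward_topology_eq_backward_topology embedding_map_def base.topspace_backward_topology .
qed

section \<open>Separation\<close>

lemma Hausdorff_related_incl:
  assumes x: "x \<in> M" and q: "q \<in> Cauchy_completion M d" and ne: "Cauchy_incl M d x \<noteq> q"
  shows "Hausdorff_related (backward_topology (Cauchy_completion M d) (quasi_dist d)) (Cauchy_incl M d x) q"
    (is "Hausdorff_related ?T ?p q")
proof (rule ccontr)
  assume nH: "\<not> Hausdorff_related ?T ?p q"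
  let ?B = "\<lambda>p n. backward_ball (Cauchy_completion M d) (quasi_dist d) p (inverse (real (Suc n)))"
  obtain t where t: "fC t" "q = cls t"
    using q by (auto elim: completionE)
  have p: "?p \<in> Cauchy_completion M d"
    using x by (rule incl_in)
  have "\<exists>y. y \<in> M \<and> Cauchy_incl M d y \<in> ?B ?p n \<inter> ?B q n" for n
  proof -
    have op: "openin ?T (?B ?p n)" "openin ?T (?B q n)"
      using p q by (simp_all add: completion.openin_backward_ball)
    moreover have "?p \<in> ?B ?p n" "q \<in> ?B q n"
      using p q by (simp_all add: completion.centre_in_backward_ball)
    ultimately obtain z where z: "z \<in> ?B ?p n \<inter> ?B q n"
      using nH unfolding Hausdorff_related_def disjnt_def by blast
    \<comment> \<open>The common point \<open>z\<close> may be a boundary point. Density replaces it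
      by a point of \<open>M\<close>, where symmetry of convergence is available.\<close>
    then have "z \<in> ?T closure_of (Cauchy_incl M d ` M)"
      unfolding closure_of_incl by (simp add: backward_ball_def)
    then show ?thesis
      using z openin_Int[OF op] unfolding in_closure_of by blast
  qed
  then have "\<exists>s. \<forall>n. s n \<in> M \<and> Cauchy_incl M d (s n) \<in> ?B ?p n \<inter> ?B q n"
    by (intro choice allI)
  then obtain s where s: "\<And>n. s n \<in> M" "\<And>n. Cauchy_incl M d (s n) \<in> ?B ?p n \<inter> ?B q n"
    by blast
  have sp: "d (s n) x < inverse (real (Suc n))" for n
    using s(2)[of n] s(1)[of n] x by (simp add: backward_ball_def quasi_dist_incl)
  have sq: "L (\<lambda>_. s n) t < ereal (inverse (real (Suc n)))" for n
    using s(2)[of n] s(1)[of n] t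
    by (simp add: backward_ball_def quasi_dist_cls Cauchy_incl_def fC_const)
  have "(\<lambda>n. d (s n) x) \<longlonglongrightarrow> 0"
    using s(1) x nonneg by (intro LIMSEQ_0_if_le_inverse less_imp_le[OF sp]) auto
  then have xs: "(\<lambda>n. d x (s n)) \<longlonglongrightarrow> 0"
    using conv_sym[of s x] s(1) x by blast
  obtain r where r: "(\<lambda>m. d x (t m)) \<longlonglongrightarrow> r" "L (\<lambda>_. x) t = ereal r" "0 \<le> r"
    using point_lim_exists[OF x t(1)] .
  have "r \<le> d x (s n) + inverse (real (Suc n))" for n
  proof -
    have "ereal r \<le> ereal (d x (s n)) + ereal (inverse (real (Suc n)))"
      using point_lim_le[OF x s(1)[of n] t(1)] r(2) add_left_mono[OF less_imp_le[OF sq[of n]]]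
      by (metis order_trans)
    then show ?thesis by simp
  qed
  moreover have "(\<lambda>n. d x (s n) + inverse (real (Suc n))) \<longlonglongrightarrow> 0 + 0"
    by (intro tendsto_add xs LIMSEQ_inverse_real_of_nat)
  ultimately have "r \<le> 0"
    using LIMSEQ_le_const[of _ "0 + 0 :: real" r] by auto
  with r have xt: "(\<lambda>m. d x (t m)) \<longlonglongrightarrow> 0" "L (\<lambda>_. x) t = 0"
    by auto
  \<comment> \<open>Second use of the symmetry of convergence, now for the representative
    \<open>t\<close>. It turns the one vanishing distance into both, so the two classes
    coincide.\<close>
  then have "(\<lambda>m. d (t m) x) \<longlonglongrightarrow> 0"
    using conv_sym[of t x] t fC_in x by blast
  then have "(\<lambda>m. L (\<lambda>_. t m) (\<lambda>_. x)) \<longlonglongrightarrow> 0"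
    by (simp add: zero_ereal_def)
  then have "L t (\<lambda>_. x) = 0"
    using LIMSEQ_unique iterated_lim_tendsto[OF t(1) fC_const[OF x]] by blast
  then have "?p = q"
    using xt t x by (simp add: Cauchy_incl_def cls_eq_iff fC_const)
  then show False using ne by simp
qed

lemma not_Hausdorff_related_imp_boundary:
  assumes "p \<in> Cauchy_completion M d" "q \<in> Cauchy_completion M d" "p \<noteq> q"
    and nH: "\<not> Hausdorff_related (backward_topology (Cauchy_completion M d) (quasi_dist d)) p q"
  shows "p \<in> Cauchy_boundary M d \<and> q \<in> Cauchy_boundary M d"
proof -
  have nH': "\<not> Hausdorff_related (backward_topology (Cauchy_completion M d) (quasi_dist d)) q p"
    using nH disjnt_sym unfolding Hausdorff_related_def by blast
  have "p \<notin> Cauchy_incl M d ` M"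
    using nH assms Hausdorff_related_incl[of _ q] by blast
  moreover have "q \<notin> Cauchy_incl M d ` M"
    using nH' assms Hausdorff_related_incl[of _ p] by blast
  ultimately show ?thesis
    using assms by (simp add: Cauchy_boundary_def)
qed

section \<open>Completeness\<close>

text \<open>Late terms of \<open>s\<close> meet each requirement separately, and since
  \<open>F\<close> is finite they meet all of them at once.\<close>

lemma approximating_point:
  assumes s: "fC s" and F: "finite F" "F \<subseteq> M" and e: "e > 0"
  shows "\<exists>y\<in>M. L (\<lambda>_. y) s \<le> ereal e \<and> (\<forall>x\<in>F. ereal (d x y) \<le> L (\<lambda>_. x) s + ereal e)"
proof -
  have "\<forall>\<^sub>F k in sequentially. L (\<lambda>_. s k) s < ereal e"
    using e by (intro order_tendstoD(2)[OF point_lim_self_tendsto_0[OF s]]) simp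
  moreover have "\<forall>\<^sub>F k in sequentially. \<forall>x\<in>F. ereal (d x (s k)) < L (\<lambda>_. x) s + ereal e"
  proof (intro eventually_ball_finite[OF F(1)] ballI)
    fix x assume "x \<in> F"
    then have x: "x \<in> M" using F by blast
    \<comment> \<open>The limit must be finite, for only then does adding \<open>e\<close> give a
      bound strictly above it.\<close>
    obtain r where r: "L (\<lambda>_. x) s = ereal r"
      using point_lim_exists[OF x s] by blast
    show "\<forall>\<^sub>F k in sequentially. ereal (d x (s k)) < L (\<lambda>_. x) s + ereal e"
      using e r by (intro order_tendstoD(2)[OF point_lim_tendsto[OF x s]]) simp
  qed
  ultimately have "\<forall>\<^sub>F k in sequentially. L (\<lambda>_. s k) s < ereal e \<and>
      (\<forall>x\<in>F. ereal (d x (s k)) < L (\<lambda>_. x) s + ereal e)"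
    by (rule eventually_conj)
  then obtain k where "L (\<lambda>_. s k) s < ereal e \<and> (\<forall>x\<in>F. ereal (d x (s k)) < L (\<lambda>_. x) s + ereal e)"
    using eventually_happens'[OF sequentially_bot] by blast
  then show ?thesis
    using fC_in[OF s] by (intro bexI[of _ "s k"]) (auto intro: less_imp_le)
qed

text \<open>The third property will make \<open>y\<close> forward Cauchy. The fourth compares
  \<open>y\<close> with the terms of every representative, which is what bounds the distance from
  the given classes to the class of \<open>y\<close>.\<close>

lemma diagonal_sequence:
  assumes s: "\<And>n. fC (s n)"
  obtains y where "\<And>n. y n \<in> M"
    and "\<And>n. L (\<lambda>_. y n) (s n) \<le> ereal (inverse (real (Suc n)))"
    and "\<And>n m. n < m \<Longrightarrow> ereal (d (y n) (y m)) \<le> L (\<lambda>_. y n) (s m) + ereal (inverse (real (Suc m)))"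
    and "\<And>i k m. \<lbrakk>i < m; k < m\<rbrakk> \<Longrightarrow>
      ereal (d (s i k) (y m)) \<le> L (\<lambda>_. s i k) (s m) + ereal (inverse (real (Suc m)))"
proof -
  define \<epsilon> :: "nat \<Rightarrow> ereal" where "\<epsilon> n = ereal (inverse (real (Suc n)))" for n
  \<comment> \<open>The state of the recursion is the current point together with the finite set of all points
    that later points have to respect.\<close>
  define P where "P n = (\<lambda>(F, y). finite F \<and> F \<subseteq> M \<and> y \<in> F \<and> L (\<lambda>_. y) (s n) \<le> \<epsilon> n \<and>
      (\<forall>i\<le>n. \<forall>k\<le>n. s i k \<in> F))" for n
  define R where "R n = (\<lambda>(F, _ :: 'a) (F', y'). F \<subseteq> F' \<and>
      (\<forall>x\<in>F. ereal (d x y') \<le> L (\<lambda>_. x) (s (Suc n)) + \<epsilon> (Suc n)))" for n :: nat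
  have next_point: "\<exists>G y'. P n (G, y') \<and> F \<subseteq> G \<and> (\<forall>x\<in>F. ereal (d x y') \<le> L (\<lambda>_. x) (s n) + \<epsilon> n)"
    if F: "finite F" "F \<subseteq> M" for F n
  proof -
    obtain y' where y': "y' \<in> M" "L (\<lambda>_. y') (s n) \<le> \<epsilon> n"
        "\<forall>x\<in>F. ereal (d x y') \<le> L (\<lambda>_. x) (s n) + \<epsilon> n"
      using approximating_point[OF s F, of "inverse (real (Suc n))" n] by (auto simp: \<epsilon>_def)
    \<comment> \<open>Besides the new point, the set takes in the block of terms
      \<open>s i k\<close> with both indices at most \<open>n\<close>, so that every term is
      respected from some stage on.\<close>
    define G where "G = insert y' (F \<union> (\<lambda>(i, k). s i k) ` ({..n} \<times> {..n}))"
    have "P n (G, y')"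
      using F y' s fC_in by (auto simp: P_def G_def)
    moreover have "F \<subseteq> G"
      by (auto simp: G_def)
    ultimately show ?thesis using y' by blast
  qed
  have "\<exists>f. \<forall>n. P n (f n) \<and> R n (f n) (f (Suc n))"
  proof (rule dependent_nat_choice)
    show "\<exists>Fy. P 0 Fy"
      using next_point[of "{}" 0] by blast
    fix Fy n assume P: "P n Fy"
    obtain F y where Fy: "Fy = (F, y)" by (cases Fy)
    obtain G y' where "P (Suc n) (G, y') \<and> F \<subseteq> G \<and>
        (\<forall>x\<in>F. ereal (d x y') \<le> L (\<lambda>_. x) (s (Suc n)) + \<epsilon> (Suc n))"
      using next_point[of F "Suc n"] P unfolding Fy P_def by auto
    then show "\<exists>Gy. P (Suc n) Gy \<and> R n Fy Gy"
      unfolding Fy R_def by (intro exI[of _ "(G, y')"]) simp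
  qed
  then obtain f where f: "\<And>n. P n (f n)" "\<And>n. R n (f n) (f (Suc n))"
    by blast
  define F where "F n = fst (f n)" for n
  define y where "y n = snd (f n)" for n
  have P: "F n \<subseteq> M" "y n \<in> F n" "L (\<lambda>_. y n) (s n) \<le> \<epsilon> n"
    "\<And>i k. i \<le> n \<Longrightarrow> k \<le> n \<Longrightarrow> s i k \<in> F n" for n
    using f(1)[of n] by (auto simp: P_def F_def y_def case_prod_beta)
  have R: "F n \<subseteq> F (Suc n)"
    "\<And>x. x \<in> F n \<Longrightarrow> ereal (d x (y (Suc n))) \<le> L (\<lambda>_. x) (s (Suc n)) + \<epsilon> (Suc n)" for n
    using f(2)[of n] by (auto simp: R_def F_def y_def case_prod_beta)
  have mono: "F n \<subseteq> F m" if "n \<le> m" for n m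
    using R(1) that by (rule lift_Suc_mono_le)
  show ?thesis
  proof (rule that[of y])
    show "y n \<in> M" for n
      using P(1,2) by blast
    show "L (\<lambda>_. y n) (s n) \<le> ereal (inverse (real (Suc n)))" for n
      using P(3) by (simp add: \<epsilon>_def)
    show "ereal (d (y n) (y m)) \<le> L (\<lambda>_. y n) (s m) + ereal (inverse (real (Suc m)))" if nm: "n < m" for n m
    proof -
      \<comment> \<open>The point \<open>y m\<close> respects the set of the stage before it, hence
        the passage to the predecessor and the strict inequalities between indices.\<close>
      obtain k where k: "m = Suc k" "n \<le> k"
        using nm by (cases m) auto
      then show ?thesis
        using R(2)[of "y n" k] P(2)[of n] mono[of n k] by (auto simp: \<epsilon>_def)
    qed
    show "ereal (d (s i k) (y m)) \<le> L (\<lambda>_. s i k) (s m) + ereal (inverse (real (Suc m)))"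
      if im: "i < m" "k < m" for i k m
    proof -
      obtain j where j: "m = Suc j" "i \<le> j" "k \<le> j"
        using im by (cases m) auto
      then show ?thesis
        using R(2)[of "s i k" j] P(4)[of i j k] by (auto simp: \<epsilon>_def)
    qed
  qed
qed

lemma forward_complete_completion: "forward_complete (Cauchy_completion M d) (quasi_dist d)"
  unfolding forward_complete_def
proof (intro allI impI)
  fix z assume z: "forward_Cauchy (Cauchy_completion M d) (quasi_dist d) z"
  have "\<exists>s. fC s \<and> z n = cls s" for n
  proof -
    have "z n \<in> Cauchy_completion M d"
      using z by (auto simp: forward_Cauchy_def)
    then obtain s where "fC s" "z n = cls s"
      by (rule completionE)
    then show ?thesis by blast
  qed
  then obtain s where s: "\<And>n. fC (s n)" "\<And>n. z n = cls (s n)"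
    by metis
  obtain y where y: "\<And>n. y n \<in> M"
    and ys: "\<And>n. L (\<lambda>_. y n) (s n) \<le> ereal (inverse (real (Suc n)))"
    and yy: "\<And>n m. n < m \<Longrightarrow> ereal (d (y n) (y m)) \<le> L (\<lambda>_. y n) (s m) + ereal (inverse (real (Suc m)))"
    and sy: "\<And>i k m. \<lbrakk>i < m; k < m\<rbrakk> \<Longrightarrow>
      ereal (d (s i k) (y m)) \<le> L (\<lambda>_. s i k) (s m) + ereal (inverse (real (Suc m)))"
    using diagonal_sequence[of s] s(1) by metis
  have tail: "\<exists>N. inverse (real (Suc N)) < e \<and> (\<forall>n m. N \<le> n \<and> n \<le> m \<longrightarrow> L (s n) (s m) \<le> ereal e)"
    if e: "e > 0" for e
  proof -
    obtain N1 where N1: "\<And>n m. N1 \<le> n \<Longrightarrow> n \<le> m \<Longrightarrow> quasi_dist d (z n) (z m) < ereal e"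
      using z e unfolding forward_Cauchy_def by meson
    obtain N2 where N2: "inverse (real (Suc N2)) < e"
      using reals_Archimedean[OF e] by blast
    have "inverse (real (Suc (max N1 N2))) \<le> inverse (real (Suc N2))"
      by (intro le_imp_inverse_le) auto
    then have "inverse (real (Suc (max N1 N2))) < e"
      using N2 by (rule order_le_less_trans)
    moreover have "L (s n) (s m) \<le> ereal e" if "N1 \<le> n" "n \<le> m" for n m
      using N1[OF that] s by (simp add: quasi_dist_cls)
    ultimately show ?thesis
      by (intro exI[of _ "max N1 N2"]) simp
  qed
  have inv_le: "inverse (real (Suc n)) < e" if "inverse (real (Suc N)) < e" "N \<le> n" for n N and e :: real
  proof -
    have "inverse (real (Suc n)) \<le> inverse (real (Suc N))"
      using that by (intro le_imp_inverse_le) auto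
    then show ?thesis
      using that(1) by (rule order_le_less_trans)
  qed
  have fCy: "fC y"
    unfolding fC_iff
  proof (intro conjI allI impI)
    fix e :: real assume "e > 0"
    then obtain N where N: "inverse (real (Suc N)) < e / 4"
      "\<And>n m. N \<le> n \<Longrightarrow> n \<le> m \<Longrightarrow> L (s n) (s m) \<le> ereal (e / 4)"
      using tail[of "e / 4"] by auto
    have "d (y n) (y m) < e" if "N \<le> n" "n \<le> m" for n m
    proof (cases "n = m")
      case True
      then show ?thesis using \<open>e > 0\<close> dist_self[OF y] by simp
    next
      case False
      then have "ereal (d (y n) (y m)) \<le> L (\<lambda>_. y n) (s m) + ereal (inverse (real (Suc m)))"
        using yy that by simp
      \<comment> \<open>Route from \<open>y n\<close> to the class of \<open>s n\<close> and on to
        that of \<open>s m\<close>. With the error \<open>1/(m+1)\<close> these are three quarters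
        of \<open>e\<close>, which leaves the final inequality strict.\<close>
      also have "\<dots> \<le> (L (\<lambda>_. y n) (s n) + L (s n) (s m)) + ereal (inverse (real (Suc m)))"
        using point_iterated_lim_le[OF y s(1) s(1)] by (rule add_right_mono)
      also have "\<dots> \<le> (ereal (e / 4) + ereal (e / 4)) + ereal (e / 4)"
        using ys[of n] inv_le[OF N(1), of n] inv_le[OF N(1), of m] N(2) that
        by (intro add_mono) (auto intro: order_trans)
      also have "\<dots> < ereal e"
        using \<open>e > 0\<close> by simp
      finally show ?thesis by simp
    qed
    then show "\<exists>N. \<forall>n m. N \<le> n \<and> n \<le> m \<longrightarrow> d (y n) (y m) < e"
      by blast
  qed (use y in auto)
  have "limitin (backward_topology (Cauchy_completion M d) (quasi_dist d)) z (cls y) sequentially"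
  proof (rule completion.limitin_backward_topologyI)
    fix e :: real assume "e > 0"
    then obtain N where N: "inverse (real (Suc N)) < e / 4"
      "\<And>n m. N \<le> n \<Longrightarrow> n \<le> m \<Longrightarrow> L (s n) (s m) \<le> ereal (e / 4)"
      using tail[of "e / 4"] by auto
    have "L (s n) y \<le> ereal (e / 2)" if "N \<le> n" for n
    proof -
      \<comment> \<open>For fixed \<open>n\<close> and \<open>k\<close>, let \<open>m\<close> grow
        past both: the passage from \<open>s n\<close> to \<open>s m\<close> and the diagonal error
        cost at most \<open>e/4\<close> each.\<close>
      have k: "L (\<lambda>_. s n k) y \<le> L (\<lambda>_. s n k) (s n) + ereal (e / 2)" for k
      proof (rule tendsto_upperbound[OF point_lim_tendsto[OF fC_in[OF s(1)] fCy]])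
        show "\<forall>\<^sub>F m in sequentially. ereal (d (s n k) (y m)) \<le> L (\<lambda>_. s n k) (s n) + ereal (e / 2)"
        proof (rule eventually_sequentiallyI)
          fix m assume m: "Suc (max n k) \<le> m"
          then have "ereal (d (s n k) (y m)) \<le> L (\<lambda>_. s n k) (s m) + ereal (inverse (real (Suc m)))"
            by (intro sy) auto
          also have "\<dots> \<le> (L (\<lambda>_. s n k) (s n) + L (s n) (s m)) + ereal (inverse (real (Suc m)))"
            using point_iterated_lim_le[OF fC_in[OF s(1)] s(1) s(1)] by (rule add_right_mono)
          also have "\<dots> \<le> (L (\<lambda>_. s n k) (s n) + ereal (e / 4)) + ereal (e / 4)"
            using less_imp_le[OF inv_le[OF N(1), of m]] N(2)[of n m] that m by (intro add_mono) auto
          also have "\<dots> = L (\<lambda>_. s n k) (s n) + ereal (e / 2)"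
            by (simp add: add.assoc)
          finally show "ereal (d (s n k) (y m)) \<le> L (\<lambda>_. s n k) (s n) + ereal (e / 2)" .
        qed
      qed simp
      \<comment> \<open>Now let \<open>k\<close> grow: the terms \<open>s n k\<close> approach their
        own class, and only \<open>e/2\<close> remains.\<close>
      have "(\<lambda>k. L (\<lambda>_. s n k) (s n) + ereal (e / 2)) \<longlonglongrightarrow> 0 + ereal (e / 2)"
        using \<open>e > 0\<close> point_lim_nonneg[OF fC_in s(1)] s(1)
        by (intro tendsto_add_ereal_nonneg point_lim_self_tendsto_0 tendsto_const) auto
      then have "L (s n) y \<le> 0 + ereal (e / 2)"
        using k by (intro LIMSEQ_le[OF iterated_lim_tendsto[OF s(1) fCy]]) auto
      then show ?thesis by simp
    qed
    moreover have "ereal (e / 2) < ereal e"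
      using \<open>e > 0\<close> by simp
    ultimately have "L (s n) y < ereal e" if "N \<le> n" for n
      using that order_le_less_trans by blast
    then have "quasi_dist d (z n) (cls y) < ereal e" if "N \<le> n" for n
      using that s fCy by (simp add: quasi_dist_cls)
    then show "\<forall>\<^sub>F n in sequentially. quasi_dist d (z n) (cls y) < ereal e"
      by (rule eventually_sequentiallyI)
  qed (use z fCy cls_in in \<open>auto simp: forward_Cauchy_def\<close>)
  then show "\<exists>l\<in>Cauchy_completion M d.
      limitin (backward_topology (Cauchy_completion M d) (quasi_dist d)) z l sequentially"
    using cls_in[OF fCy] by blast
qed

section \<open>The symmetrized completion\<close>

text \<open>Against a constant sequence, \<open>L t (\<lambda>_. x)\<close> is a plain limit of
  distances. Conversely, symmetry of convergence makes both distances to \<open>x\<close> vanish,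
  and the triangle inequality through \<open>x\<close> makes \<open>t\<close> forward
  Cauchy.\<close>

lemma in_Cauchy_incl_iff:
  assumes x: "x \<in> M"
  shows "t \<in> Cauchy_incl M d x \<longleftrightarrow> range t \<subseteq> M \<and> (\<lambda>n. d (t n) x) \<longlonglongrightarrow> 0"
proof
  assume "t \<in> Cauchy_incl M d x"
  then have t: "fC t" "L t (\<lambda>_. x) = 0"
    by (auto simp: Cauchy_incl_def Cauchy_rel_def)
  have "(\<lambda>n. ereal (d (t n) x)) \<longlonglongrightarrow> ereal 0"
    using iterated_lim_tendsto[OF t(1) fC_const[OF x]] t(2) by (simp add: zero_ereal_def)
  then show "range t \<subseteq> M \<and> (\<lambda>n. d (t n) x) \<longlonglongrightarrow> 0"
    using t(1) by (simp add: forward_Cauchy_def)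
next
  assume t: "range t \<subseteq> M \<and> (\<lambda>n. d (t n) x) \<longlonglongrightarrow> 0"
  then have tM: "\<And>n. t n \<in> M" and tx: "(\<lambda>n. d (t n) x) \<longlonglongrightarrow> 0" and xt: "(\<lambda>n. d x (t n)) \<longlonglongrightarrow> 0"
    using conv_sym[of t x] x by auto
  have fCt: "fC t"
    unfolding fC_iff
  proof (intro conjI allI impI)
    fix e :: real assume "e > 0"
    then have "\<forall>\<^sub>F n in sequentially. d (t n) x < e / 2 \<and> d x (t n) < e / 2"
      by (intro eventually_conj order_tendstoD(2)[OF tx] order_tendstoD(2)[OF xt]) auto
    then obtain N where N: "\<And>n. N \<le> n \<Longrightarrow> d (t n) x < e / 2 \<and> d x (t n) < e / 2"
      unfolding eventually_sequentially by blast
    have "d (t n) (t m) < e" if "N \<le> n" "n \<le> m" for n m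
      using triangle[OF tM x tM, of n m] N[of n] N[of m] that by linarith
    then show "\<exists>N. \<forall>n m. N \<le> n \<and> n \<le> m \<longrightarrow> d (t n) (t m) < e"
      by blast
  qed (use t in blast)
  have "(\<lambda>n. ereal (d x (t n))) \<longlonglongrightarrow> 0" "(\<lambda>n. L (\<lambda>_. t n) (\<lambda>_. x)) \<longlonglongrightarrow> 0"
    using tx xt by (simp_all add: zero_ereal_def)
  then have "L (\<lambda>_. x) t = 0" "L t (\<lambda>_. x) = 0"
    using LIMSEQ_unique[OF point_lim_tendsto[OF x fCt]]
      LIMSEQ_unique[OF iterated_lim_tendsto[OF fCt fC_const[OF x]]] by blast+
  then show "t \<in> Cauchy_incl M d x"
    using fCt fC_const[OF x] by (simp add: Cauchy_incl_def Cauchy_rel_def)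
qed

text \<open>By \<open>in_Cauchy_incl_iff\<close> both classes collect the sequences converging to
  \<open>x\<close>, and convergence to a point of \<open>M\<close> is insensitive to
  reversal.\<close>

lemma Cauchy_incl_rev_dist:
  assumes "x \<in> M"
  shows "Cauchy_incl M (rev_dist d) x = Cauchy_incl M d x"
proof (rule set_eqI)
  fix t
  show "t \<in> Cauchy_incl M (rev_dist d) x \<longleftrightarrow> t \<in> Cauchy_incl M d x"
    using conv_sym[of t x] assms
    unfolding in_Cauchy_incl_iff[OF assms] generalized_metric_space.in_Cauchy_incl_iff[OF rev_space assms]
    by (auto simp: rev_dist_def)
qed

lemma sym_completion_subset:
  "sym_completion M d \<subseteq> Cauchy_completion M d \<inter> Cauchy_completion M (rev_dist d)"
proof -
  have "Cauchy_incl M d x \<in> Cauchy_completion M (rev_dist d)" if "x \<in> M" for x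
    using generalized_metric_space.incl_in[OF rev_space that] Cauchy_incl_rev_dist[OF that] by simp
  then show ?thesis
    using incl_in by (auto simp: sym_completion_def sym_boundary_def Cauchy_boundary_def)
qed

section \<open>Sequences that are Cauchy in both directions\<close>

lemma forward_backward_Cauchy:
  assumes s: "fC s" "forward_Cauchy M (ext_dist (rev_dist d)) s" and e: "e > 0"
  obtains N where "\<And>n m. N \<le> n \<Longrightarrow> N \<le> m \<Longrightarrow> d (s n) (s m) < e"
proof -
  have "\<exists>N. \<forall>n m. N \<le> n \<and> n \<le> m \<longrightarrow> d (s n) (s m) < e"
    using s(1) e by (simp add: fC_iff)
  then obtain N1 where N1: "\<And>n m. N1 \<le> n \<Longrightarrow> n \<le> m \<Longrightarrow> d (s n) (s m) < e"
    by blast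
  have "\<exists>N. \<forall>n m. N \<le> n \<and> n \<le> m \<longrightarrow> d (s m) (s n) < e"
    using s(2) e by (simp add: generalized_metric_space.fC_iff[OF rev_space] rev_dist_def)
  then obtain N2 where N2: "\<And>n m. N2 \<le> n \<Longrightarrow> n \<le> m \<Longrightarrow> d (s m) (s n) < e"
    by blast
  show ?thesis
  proof (rule that[of "max N1 N2"])
    fix n m assume "max N1 N2 \<le> n" "max N1 N2 \<le> m"
    then show "d (s n) (s m) < e"
      using N1[of n m] N2[of m n] by (cases "n \<le> m") auto
  qed
qed

lemma iterated_lim_eq_diagonal_lim:
  assumes s: "fC s" "forward_Cauchy M (ext_dist (rev_dist d)) s"
    and t: "fC t" "forward_Cauchy M (ext_dist (rev_dist d)) t"
  obtains r where "(\<lambda>n. d (s n) (t n)) \<longlonglongrightarrow> r" "L s t = ereal r"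
proof -
  have M: "s n \<in> M" "t n \<in> M" for n
    using s(1) t(1) fC_in by auto
  \<comment> \<open>Three free indices serve two purposes: \<open>k = n\<close> makes the diagonal a
    Cauchy sequence, and \<open>m = n\<close> compares the inner limit with the diagonal.\<close>
  have close: "\<exists>N. \<forall>n m k. N \<le> n \<longrightarrow> N \<le> m \<longrightarrow> N \<le> k \<longrightarrow> \<bar>d (s n) (t k) - d (s m) (t m)\<bar> < e"
    if e: "e > 0" for e
  proof -
    obtain N1 where N1: "\<And>n m. N1 \<le> n \<Longrightarrow> N1 \<le> m \<Longrightarrow> d (s n) (s m) < e / 2"
      using forward_backward_Cauchy[OF s, of "e / 2"] e by auto
    obtain N2 where N2: "\<And>n m. N2 \<le> n \<Longrightarrow> N2 \<le> m \<Longrightarrow> d (t n) (t m) < e / 2"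
      using forward_backward_Cauchy[OF t, of "e / 2"] e by auto
    have "\<bar>d (s n) (t k) - d (s m) (t m)\<bar> < e"
      if "max N1 N2 \<le> n" "max N1 N2 \<le> m" "max N1 N2 \<le> k" for n m k
    proof -
      have "d (s n) (t k) \<le> d (s n) (s m) + (d (s m) (t m) + d (t m) (t k))"
        using triangle[of "s n" "s m" "t k"] triangle[of "s m" "t m" "t k"] M by fastforce
      moreover have "d (s m) (t m) \<le> d (s m) (s n) + (d (s n) (t k) + d (t k) (t m))"
        using triangle[of "s m" "s n" "t m"] triangle[of "s n" "t k" "t m"] M by fastforce
      moreover have "d (s n) (s m) < e / 2" "d (s m) (s n) < e / 2"
        "d (t m) (t k) < e / 2" "d (t k) (t m) < e / 2"
        using N1 N2 that by auto
      ultimately show ?thesis by linarith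
    qed
    then show ?thesis by blast
  qed
  have "Cauchy (\<lambda>n. d (s n) (t n))"
  proof (rule CauchyI)
    fix e :: real assume "e > 0"
    then obtain N where "\<forall>n m k. N \<le> n \<longrightarrow> N \<le> m \<longrightarrow> N \<le> k \<longrightarrow> \<bar>d (s n) (t k) - d (s m) (t m)\<bar> < e"
      using close by blast
    then show "\<exists>N. \<forall>m\<ge>N. \<forall>n\<ge>N. norm (d (s m) (t m) - d (s n) (t n)) < e"
      unfolding real_norm_def by blast
  qed
  then obtain r where r: "(\<lambda>n. d (s n) (t n)) \<longlonglongrightarrow> r"
    using Cauchy_convergent unfolding convergent_def by blast
  have "\<exists>h. (\<lambda>k. d (s n) (t k)) \<longlonglongrightarrow> h \<and> L (\<lambda>_. s n) t = ereal h" for n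
    using point_lim_exists[OF M(1) t(1)] by blast
  then have "\<exists>h. \<forall>n. (\<lambda>k. d (s n) (t k)) \<longlonglongrightarrow> h n \<and> L (\<lambda>_. s n) t = ereal (h n)"
    by (intro choice allI)
  then obtain h where h: "\<And>n. (\<lambda>k. d (s n) (t k)) \<longlonglongrightarrow> h n" "\<And>n. L (\<lambda>_. s n) t = ereal (h n)"
    by blast
  \<comment> \<open>The inner limits \<open>h n\<close> merge with the diagonal, so the outer limit
    is the diagonal limit \<open>r\<close>, in particular finite.\<close>
  have "(\<lambda>n. h n - d (s n) (t n)) \<longlonglongrightarrow> 0"
  proof (rule LIMSEQ_I)
    fix e :: real assume "e > 0"
    then obtain N where N: "\<forall>n m k. N \<le> n \<longrightarrow> N \<le> m \<longrightarrow> N \<le> k \<longrightarrow> \<bar>d (s n) (t k) - d (s m) (t m)\<bar> < e / 2"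
      using close[of "e / 2"] by auto
    have "norm (h n - d (s n) (t n) - 0) < e" if "N \<le> n" for n
    proof -
      have "(\<lambda>k. \<bar>d (s n) (t k) - d (s n) (t n)\<bar>) \<longlonglongrightarrow> \<bar>h n - d (s n) (t n)\<bar>"
        by (intro tendsto_intros h)
      then have "\<bar>h n - d (s n) (t n)\<bar> \<le> e / 2"
        using N that by (intro LIMSEQ_le_const2) (auto intro!: exI[of _ N] less_imp_le)
      then show ?thesis using \<open>e > 0\<close> by simp
    qed
    then show "\<exists>N. \<forall>n\<ge>N. norm (h n - d (s n) (t n) - 0) < e"
      by blast
  qed
  from tendsto_add[OF this r] have "(\<lambda>n. L (\<lambda>_. s n) t) \<longlonglongrightarrow> ereal r"
    by (simp add: h(2))
  then have "L s t = ereal r"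
    using LIMSEQ_unique iterated_lim_tendsto[OF s(1) t(1)] by blast
  with r show ?thesis by (rule that)
qed

lemma quasi_dist_sym_completion:
  assumes "p \<in> sym_completion M d" "q \<in> sym_completion M d"
  shows "quasi_dist d p q = ereal (real_of_ereal (quasi_dist d p q))"
    and "quasi_dist (rev_dist d) p q = quasi_dist d q p"
proof -
  note rev_completion_eq_cls = generalized_metric_space.completion_eq_cls[OF rev_space]
  have pq: "p \<in> Cauchy_completion M d" "p \<in> Cauchy_completion M (rev_dist d)"
    "q \<in> Cauchy_completion M d" "q \<in> Cauchy_completion M (rev_dist d)"
    using assms sym_completion_subset by blast+
  obtain s where s: "fC s" "p = cls s"
    using pq(1) by (rule completionE)
  obtain t where t: "fC t" "q = cls t"
    using pq(3) by (rule completionE)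
  \<comment> \<open>A point of the symmetrized completion is the same set of sequences in both
    completions, so \<open>s\<close> represents it in each.\<close>
  have s': "forward_Cauchy M (ext_dist (rev_dist d)) s" "p = Cauchy_rel M (rev_dist d) `` {s}"
    using rev_completion_eq_cls[OF pq(2), of s] in_cls_self[OF s(1)] s(2) by simp_all
  have t': "forward_Cauchy M (ext_dist (rev_dist d)) t" "q = Cauchy_rel M (rev_dist d) `` {t}"
    using rev_completion_eq_cls[OF pq(4), of t] in_cls_self[OF t(1)] t(2) by simp_all
  obtain r where "L s t = ereal r"
    using iterated_lim_eq_diagonal_lim[OF s(1) s'(1) t(1) t'(1)] by blast
  then show "quasi_dist d p q = ereal (real_of_ereal (quasi_dist d p q))"
    using s t by (simp add: quasi_dist_cls)
  obtain r1 where r1: "(\<lambda>n. d (t n) (s n)) \<longlonglongrightarrow> r1" "L t s = ereal r1"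
    using iterated_lim_eq_diagonal_lim[OF t(1) t'(1) s(1) s'(1)] .
  \<comment> \<open>For \<open>rev_dist d\<close> the limits of \<open>d (t m) (s n)\<close> are
    taken in the opposite order to those in \<open>L t s\<close>. Both reduce to the limit of
    \<open>d (t n) (s n)\<close>, so \<open>r1\<close> and \<open>r2\<close> agree.\<close>
  obtain r2 where r2: "(\<lambda>n. rev_dist d (s n) (t n)) \<longlonglongrightarrow> r2" "iterated_lim (rev_dist d) s t = ereal r2"
    using generalized_metric_space.iterated_lim_eq_diagonal_lim[OF rev_space s'(1) _ t'(1)] s(1) t(1)
    unfolding rev_dist_rev_dist by blast
  have "r1 = r2"
    using r1(1) r2(1) LIMSEQ_unique unfolding rev_dist_def by blast
  moreover have "quasi_dist (rev_dist d) p q = iterated_lim (rev_dist d) s t"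
    unfolding s'(2) t'(2) using s'(1) t'(1) by (rule generalized_metric_space.quasi_dist_cls[OF rev_space])
  moreover have "quasi_dist d q p = L t s"
    unfolding s(2) t(2) using t(1) s(1) by (rule quasi_dist_cls)
  ultimately show "quasi_dist (rev_dist d) p q = quasi_dist d q p"
    using r1 r2 by simp
qed

lemma sym_completion_metric:
  obtains \<delta> where "\<And>p q. p \<in> sym_completion M d \<Longrightarrow> q \<in> sym_completion M d \<Longrightarrow>
      sym_dist d p q = ereal (\<delta> p q)"
    and "Metric_space (sym_completion M d) \<delta>"
proof -
  let ?S = "sym_completion M d"
  define \<rho> where "\<rho> p q = real_of_ereal (quasi_dist d p q)" for p q
  \<comment> \<open>The value 0 off the carrier is there because \<open>Metric_space\<close> demands
    nonnegativity and symmetry for all arguments.\<close>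
  define \<delta> where "\<delta> p q = (if p \<in> ?S \<and> q \<in> ?S then (\<rho> p q + \<rho> q p) / 2 else 0)" for p q
  have \<rho>: "quasi_dist d p q = ereal (\<rho> p q)" if "p \<in> ?S" "q \<in> ?S" for p q
    using quasi_dist_sym_completion(1)[OF that] by (simp add: \<rho>_def)
  have C: "p \<in> Cauchy_completion M d" if "p \<in> ?S" for p
    using that sym_completion_subset by blast
  have nonneg: "0 \<le> \<rho> p q" if "p \<in> ?S" "q \<in> ?S" for p q
    using completion.nonneg[OF C[OF that(1)] C[OF that(2)]] \<rho>[OF that] by simp
  have tri: "\<rho> p r \<le> \<rho> p q + \<rho> q r" if "p \<in> ?S" "q \<in> ?S" "r \<in> ?S" for p q r
    using completion.triangle[OF C[OF that(1)] C[OF that(2)] C[OF that(3)]] \<rho> that by simp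
  have zero: "\<rho> p q = 0 \<and> \<rho> q p = 0 \<longleftrightarrow> p = q" if "p \<in> ?S" "q \<in> ?S" for p q
    using completion.zero[OF C[OF that(1)] C[OF that(2)]] \<rho> that by simp
  have "sym_dist d p q = ereal (\<delta> p q)" if "p \<in> ?S" "q \<in> ?S" for p q
    using that quasi_dist_sym_completion(2)[OF that] \<rho>[OF that] \<rho>[OF that(2,1)]
    by (simp add: sym_dist_def \<delta>_def)
  moreover have "Metric_space ?S \<delta>"
  proof
    fix p q r
    show "0 \<le> \<delta> p q"
      using nonneg by (simp add: \<delta>_def)
    show "\<delta> p q = \<delta> q p"
      by (simp add: \<delta>_def add.commute)
    assume pq: "p \<in> ?S" "q \<in> ?S"
    show "\<delta> p q = 0 \<longleftrightarrow> p = q"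
      using zero[OF pq] nonneg[OF pq] nonneg[OF pq(2,1)] pq
      by (simp add: \<delta>_def add_nonneg_eq_0_iff)
    assume r: "r \<in> ?S"
    show "\<delta> p r \<le> \<delta> p q + \<delta> q r"
      using tri[OF pq r] tri[OF r pq(2,1)] pq r by (simp add: \<delta>_def field_simps)
  qed
  ultimately show ?thesis using that by blast
qed

end

theorem theorem3p29:
  fixes M :: "'a set" and d :: "'a \<Rightarrow> 'a \<Rightarrow> real"
  assumes "generalized_metric_space M d"
  defines "X \<equiv> forward_topology M (ext_dist d)"
    and "C \<equiv> Cauchy_completion M d"
    and "T \<equiv> backward_topology (Cauchy_completion M d) (quasi_dist d)"
    and "C' \<equiv> Cauchy_completion M (rev_dist d)"
    and "T' \<equiv> backward_topology (Cauchy_completion M (rev_dist d)) (quasi_dist (rev_dist d))"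
  shows
    "(t0_space T \<and>
      (\<forall>p \<in> C. \<forall>q \<in> C. p \<noteq> q \<and> \<not> Hausdorff_related T p q \<longrightarrow>
        p \<in> Cauchy_boundary M d \<and> q \<in> Cauchy_boundary M d)) \<and>
     (embedding_map X T (Cauchy_incl M d) \<and>
      T closure_of (Cauchy_incl M d ` M) = C) \<and>
     forward_complete C (quasi_dist d) \<and>
     (t0_space T' \<and>
      (\<forall>p \<in> C'. \<forall>q \<in> C'. p \<noteq> q \<and> \<not> Hausdorff_related T' p q \<longrightarrow>
        p \<in> Cauchy_boundary M (rev_dist d) \<and> q \<in> Cauchy_boundary M (rev_dist d))) \<and>
     (embedding_map X T' (Cauchy_incl M (rev_dist d)) \<and>
      T' closure_of (Cauchy_incl M (rev_dist d) ` M) = C') \<and>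
     forward_complete C' (quasi_dist (rev_dist d)) \<and>
     (\<exists>\<delta>. (\<forall>p \<in> sym_completion M d. \<forall>q \<in> sym_completion M d. sym_dist d p q = ereal (\<delta> p q)) \<and>
        Metric_space (sym_completion M d) \<delta> \<and>
        Hausdorff_space (Metric_space.mtopology (sym_completion M d) \<delta>))"
proof -
  interpret G: generalized_metric_space M d
    by fact
  interpret R: generalized_metric_space M "rev_dist d"
    by (rule G.rev_space)
  \<comment> \<open>Both embeddings must start from the same topology on \<open>M\<close>. The
    forward and backward topologies of the reversed distance agree, and the latter is the forward
    topology of \<open>d\<close>.\<close>
  have X_rev: "X = forward_topology M (ext_dist (rev_dist d))"
    unfolding X_def R.forward_topology_eq_backward_topology
    by (simp add: forward_topology_eq_backward ext_dist_rev_dist)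
  obtain \<delta> where "\<And>p q. p \<in> sym_completion M d \<Longrightarrow> q \<in> sym_completion M d \<Longrightarrow>
      sym_dist d p q = ereal (\<delta> p q)"
    and "Metric_space (sym_completion M d) \<delta>"
    using G.sym_completion_metric by blast
  then have sym: "\<exists>\<delta>. (\<forall>p \<in> sym_completion M d. \<forall>q \<in> sym_completion M d. sym_dist d p q = ereal (\<delta> p q)) \<and>
        Metric_space (sym_completion M d) \<delta> \<and>
        Hausdorff_space (Metric_space.mtopology (sym_completion M d) \<delta>)"
    using Metric_space.Hausdorff_space_mtopology by blast
  have sep: "\<forall>p \<in> C. \<forall>q \<in> C. p \<noteq> q \<and> \<not> Hausdorff_related T p q \<longrightarrow>
      p \<in> Cauchy_boundary M d \<and> q \<in> Cauchy_boundary M d"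
    unfolding C_def T_def by (intro ballI impI G.not_Hausdorff_related_imp_boundary) auto
  have sep_rev: "\<forall>p \<in> C'. \<forall>q \<in> C'. p \<noteq> q \<and> \<not> Hausdorff_related T' p q \<longrightarrow>
      p \<in> Cauchy_boundary M (rev_dist d) \<and> q \<in> Cauchy_boundary M (rev_dist d)"
    unfolding C'_def T'_def by (intro ballI impI R.not_Hausdorff_related_imp_boundary) auto
  have emb_rev: "embedding_map X T' (Cauchy_incl M (rev_dist d))"
    unfolding X_rev T'_def by (rule R.embedding_map_incl)
  show ?thesis
    using sep sep_rev emb_rev sym
      G.completion.t0_space_backward_topology R.completion.t0_space_backward_topology
      G.embedding_map_incl G.closure_of_incl R.closure_of_incl
      G.forward_complete_completion R.forward_complete_completion
    unfolding X_def C_def T_def C'_def T'_def by (intro conjI)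
qed

end
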